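(* Let $p>1$ and let $f,g,\rho,d$ satisfy the standing assumptions. Assume that the limit $\ell_0:=\lim_{u\to0^+}\rho(u)\left(\frac{d(u)}{u}\right)^{\frac1{p-1}}$ exists and $\ell_0<+\infty$, and let $c^*$ be the threshold speed. Let $u$ be a traveling wave solution, defined in $(\alpha,\beta)$, with speed $c=c^*$. Then: (a) if $\ell_0>0$, then $\beta<+\infty$ if and only if $\int_0^{1/2}\frac1{\rho(u)}\,du<+\infty$; (b) if $\ell_0=0$ and $c^*g(0)>f(0)$, then $\beta<+\infty$ if and only if $\int_0^{1/2}\left(\frac{d(u)}{u}\right)^{\frac1{p-1}}du<+\infty$; (c) if $\ell_0=c^*g(0)-f(0)=0$ and there exist three constants $\delta,\mu,M>0$ and a function $\xi\in C^1[0,\delta]$ such that $\mu\,\xi(u)\le d(u)(\rho(u))^{p-1}\le M\,\xi(u)$ for every $u\in(0,\delta)$, then $\int_0^{1/2}\frac1{\rho(u)}\,du<+\infty$ implies $\beta<+\infty$.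
   Context: Standing assumptions: $p>1$; $f,g,\rho\in C[0,1]$; $d\in C^1(0,1)$; $\rho(u)>0$ in $(0,1)$ and $\rho(0)=\rho(1)=0$; $g(0)>0$ and $\int_0^u g(s)\,ds>0$ for every $u\in(0,1]$; $d(u)>0$ in $(0,1)$ and $\rho\, d^{\frac1{p-1}}\in L^1(0,1)$. A traveling wave solution (t.w.s.) with speed $c\in\mathbb R$ is a function $u\in C^1(\alpha,\beta)$, with $-\infty\le\alpha<\beta\le+\infty$, such that $0<u(t)<1$ for all $t\in(\alpha,\beta)$, $d(u)|u'|^{p-2}u'\in C^1(\alpha,\beta)$, $$(d(u)|u'|^{p-2}u')'+(cg(u)-f(u))u'+\rho(u)=0\quad\text{in }(\alpha,\beta),$$ $u(\alpha^+)=1$, $u(\beta^-)=0$, and $\lim_{t\to\alpha^+}d(u)|u'|^{p-2}u'=\lim_{t\to\beta^-}d(u)|u'|^{p-2}u'=0$. When $\ell_0$ exists and is finite, there is a threshold $c^*\in\mathbb R$ such that a t.w.s. with speed $c$ exists if and only if $c\ge c^*$. *)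

theory Defs
  imports "HOL-Analysis.Analysis"
begin

text \<open>Here \<open>powr\<close> satisfies \<open>0 powr a = 0\<close> for every \<open>a\<close>, so the flux vanishes at critical
  points of \<open>u\<close> for every \<open>p > 1\<close>, also in the singular case \<open>p < 2\<close>.\<close>

definition flux :: "real \<Rightarrow> (real \<Rightarrow> real) \<Rightarrow> (real \<Rightarrow> real) \<Rightarrow> real \<Rightarrow> real" where
  "flux p d u t = d (u t) * \<bar>deriv u t\<bar> powr (p - 2) * deriv u t"

text \<open>The endpoints are extended reals; a limit of \<open>h \<circ> real_of_ereal\<close> along \<open>at_right \<alpha>\<close> or
  \<open>at_left \<beta>\<close> is the one-sided limit of \<open>h\<close> at a finite endpoint, and the limit of \<open>h\<close> at
  minus or plus infinity otherwise.\<close>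

definition travelling_wave ::
  "real \<Rightarrow> (real \<Rightarrow> real) \<Rightarrow> (real \<Rightarrow> real) \<Rightarrow> (real \<Rightarrow> real) \<Rightarrow> (real \<Rightarrow> real) \<Rightarrow>
    real \<Rightarrow> ereal \<Rightarrow> ereal \<Rightarrow> (real \<Rightarrow> real) \<Rightarrow> bool" where
  "travelling_wave p f g \<rho> d c \<alpha> \<beta> u \<longleftrightarrow>
     \<alpha> < \<beta> \<and>
     u C1_differentiable_on (einterval \<alpha> \<beta>) \<and>
     (\<forall>t\<in>einterval \<alpha> \<beta>. 0 < u t \<and> u t < 1) \<and>
     flux p d u C1_differentiable_on (einterval \<alpha> \<beta>) \<and>
     (\<forall>t\<in>einterval \<alpha> \<beta>.
        deriv (flux p d u) t + (c * g (u t) - f (u t)) * deriv u t + \<rho> (u t) = 0) \<and>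
     ((u \<circ> real_of_ereal) \<longlongrightarrow> 1) (at_right \<alpha>) \<and>
     ((u \<circ> real_of_ereal) \<longlongrightarrow> 0) (at_left \<beta>) \<and>
     ((flux p d u \<circ> real_of_ereal) \<longlongrightarrow> 0) (at_right \<alpha>) \<and>
     ((flux p d u \<circ> real_of_ereal) \<longlongrightarrow> 0) (at_left \<beta>)"

definition threshold_speed ::
  "real \<Rightarrow> (real \<Rightarrow> real) \<Rightarrow> (real \<Rightarrow> real) \<Rightarrow> (real \<Rightarrow> real) \<Rightarrow> (real \<Rightarrow> real) \<Rightarrow> real \<Rightarrow> bool" where
  "threshold_speed p f g \<rho> d cs \<longleftrightarrow>
     (\<forall>c. (\<exists>\<alpha> \<beta> u. travelling_wave p f g \<rho> d c \<alpha> \<beta> u) \<longleftrightarrow> cs \<le> c)"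

text \<open>Continuous differentiability on a closed interval is one-sided at the endpoints, whereas
  \<open>C1_differentiable_on\<close> asks for two-sided derivatives.\<close>

definition C1_on_closed_interval :: "real \<Rightarrow> real \<Rightarrow> (real \<Rightarrow> real) \<Rightarrow> bool" where
  "C1_on_closed_interval a b h \<longleftrightarrow>
     (\<exists>h'. continuous_on {a..b} h' \<and>
           (\<forall>x\<in>{a..b}. (h has_real_derivative h' x) (at x within {a..b})))"

end

theory Submission
  imports Defs
begin

text \<open>Put \<open>r = 1 / (p - 1)\<close>, \<open>D = \<rho> d powr r\<close> and \<open>h = c g - f\<close>. A travelling wave is strictly
  decreasing, since its flux can only cross \<open>0\<close> downwards; hence minus the flux is a function \<open>y\<close> of
  the value \<open>u\<close>, positive on \<open>(0,1)\<close>, vanishing at both ends and satisfying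
  \<open>y' = h - D y powr (- r)\<close>. Conversely every such profile \<open>y\<close> yields a wave, and \<open>\<beta>\<close> is finite if and
  only if \<open>(d / y) powr r = (1 / \<rho>) D y powr (- r)\<close> is integrable at \<open>0\<close>.

  Always \<open>y \<le> H u\<close>, where \<open>H\<close> bounds \<open>h\<close>. If \<open>D \<ge> m \<xi> powr r\<close> with \<open>\<xi>\<close> of class \<open>C\<^sup>1\<close>, then
  \<open>y \<ge> \<epsilon> \<xi>\<close> near \<open>0\<close>, since otherwise \<open>y\<close> would decrease from the value \<open>0\<close>; this gives (a) with
  \<open>\<xi> u = u\<close>, and (c). In (b) the bound \<open>y \<ge> \<epsilon> u\<close> comes from the minimality of the speed: if it
  failed, then it would fail for the profiles with slightly smaller speed, and these would vanish at
  \<open>0\<close> as well. Such profiles are obtained by solving the equation backwards from points near \<open>1\<close>;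
  in that direction it is dissipative, so the solutions stay close to \<open>y\<close> and converge.\<close>

section \<open>The profile equation\<close>

text \<open>At the first point where \<open>\<phi>\<close> has fallen to a positive level
  \<open>L < \<phi> a\<close> it would still have been nondecreasing, since
  \<open>\<phi> > L\<close> before that point. In the barrier arguments below \<open>\<phi>\<close>
  measures by how much an inequality fails, so slopes have to be compared only where it
  fails.\<close>

lemma DERIV_nonneg_while_pos_imp_nondecreasing:
  fixes \<phi> :: "real \<Rightarrow> real"
  assumes "a \<le> b" and cont: "continuous_on {a..b} \<phi>" and pos: "\<phi> a > 0"
    and der: "\<And>x. \<lbrakk>a < x; x < b; \<phi> x > 0\<rbrakk> \<Longrightarrow> \<exists>m. (\<phi> has_real_derivative m) (at x) \<and> m \<ge> 0"
  shows "\<phi> a \<le> \<phi> b"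
proof (rule ccontr)
  assume "\<not> \<phi> a \<le> \<phi> b"
  \<comment> \<open>The maximum with \<open>\<phi> a / 2\<close> keeps the level positive even if
    \<open>\<phi> b\<close> is not.\<close>
  define L where "L = max (\<phi> b) (\<phi> a / 2)"
  have L: "0 < L" "L < \<phi> a" "\<phi> b \<le> L"
    using pos \<open>\<not> \<phi> a \<le> \<phi> b\<close> by (auto simp: L_def)
  define S where "S = {x \<in> {a..b}. \<phi> x \<le> L}"
  have "closed S" unfolding S_def
    by (intro continuous_closed_preimage_constant continuous_on_closed_Collect_le cont
        continuous_on_const) auto
  moreover have "bounded S" unfolding S_def by (rule bounded_subset[of "{a..b}"]) auto
  ultimately have "compact S" by (simp add: compact_eq_bounded_closed)
  moreover have "b \<in> S" using L \<open>a \<le> b\<close> by (auto simp: S_def)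
  ultimately obtain v where v: "v \<in> S" "\<And>x. x \<in> S \<Longrightarrow> v \<le> x"
    using compact_attains_inf[of S] by auto
  have "\<phi> a \<le> \<phi> v"
  proof (rule DERIV_nonneg_imp_increasing_open[of a v \<phi>])
    show "a \<le> v" using v by (auto simp: S_def)
    show "continuous_on {a..v} \<phi>" using cont v by (auto simp: S_def intro: continuous_on_subset)
    fix x assume "a < x" "x < v"
    then have "x \<notin> S" using v(2) by force
    then have "\<phi> x > 0" using \<open>a < x\<close> \<open>x < v\<close> v(1) L(1) by (auto simp: S_def)
    with der show "\<exists>y. (\<phi> has_real_derivative y) (at x) \<and> 0 \<le> y"
      using \<open>a < x\<close> \<open>x < v\<close> v(1) by (auto simp: S_def)
  qed
  with v(1) L show False by (auto simp: S_def)
qed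

text \<open>A global Lipschitz constant in the second argument lets one application of the Banach
  fixed point theorem cover the whole interval. The value is prescribed at the right end because
  profiles are solved backwards.\<close>

lemma lipschitz_terminal_value_problem:
  fixes F :: "real \<Rightarrow> real \<Rightarrow> real"
  assumes "a < b" and "L > 0"
    and cont: "\<And>w. continuous_on {a..b} w \<Longrightarrow> continuous_on {a..b} (\<lambda>s. F s (w s))"
    and lip: "\<And>s x y. s \<in> {a..b} \<Longrightarrow> \<bar>F s x - F s y\<bar> \<le> L * \<bar>x - y\<bar>"
  shows "\<exists>y. y b = yb \<and> (\<forall>s\<in>{a..b}. (y has_real_derivative F s (y s)) (at s within {a..b}))"
proof -
  \<comment> \<open>The exponential weight makes the integral operator a contraction on all of \<open>{a..b}\<close>.\<close>
  define E where "E = (\<lambda>s. exp (2 * L * (b - s)))"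
  define G where "G w v = inverse (E v) * (yb - integral {v..b} (\<lambda>s. F s (E s * w s)))"
    for w :: "real \<Rightarrow> real" and v
  have contF: "continuous_on {a..b} (\<lambda>s. F s (E s * w s))" if "continuous_on {a..b} w" for w
    unfolding E_def by (rule cont) (intro continuous_intros that)
  have contG: "continuous_on {a..b} (G w)" if "continuous_on {a..b} w" for w
    unfolding G_def
  proof (intro continuous_intros)
    show "continuous_on {a..b} (\<lambda>v. integral {v..b} (\<lambda>s. F s (E s * w s)))"
      unfolding continuous_on_eq_continuous_within
      by (intro ballI DERIV_continuous[OF integral_has_real_derivative'[OF contF[OF that]]])
    show "continuous_on {a..b} E" unfolding E_def by (intro continuous_intros)
  qed (auto simp: E_def)
  \<comment> \<open>Clamping the argument to \<open>{a..b}\<close> extends \<open>G w\<close> by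
    constants, so that the fixed point is sought in the complete space of bounded continuous
    functions on the whole line.\<close>
  define P where "P w = Bcontfun (\<lambda>x. G (apply_bcontfun w) (max a (min b x)))"
    for w :: "real \<Rightarrow>\<^sub>C real"
  have P: "apply_bcontfun (P w) x = G (apply_bcontfun w) (max a (min b x))" for w x
  proof -
    have "continuous_on UNIV (\<lambda>x. G (apply_bcontfun w) (max a (min b x)))"
      by (rule continuous_on_compose2[OF contG]) (use \<open>a < b\<close> in \<open>auto intro!: continuous_intros\<close>)
    moreover have "range (\<lambda>x. G (apply_bcontfun w) (max a (min b x))) \<subseteq> G (apply_bcontfun w) ` {a..b}"
      using \<open>a < b\<close> by auto
    moreover have "bounded (G (apply_bcontfun w) ` {a..b})"
      by (intro compact_imp_bounded compact_continuous_image contG) auto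
    ultimately show ?thesis unfolding P_def
      by (subst Bcontfun_inverse) (auto simp: bcontfun_def intro: bounded_subset)
  qed
  have "\<exists>!w. P w = w"
  proof (rule banach_fix_type[of "1/2"])
    show "\<forall>v w. dist (P v) (P w) \<le> 1/2 * dist v w"
    proof (intro allI dist_bound)
      fix v w :: "real \<Rightarrow>\<^sub>C real" and x
      define t where "t = max a (min b x)"
      have t: "t \<in> {a..b}" "{t..b} \<subseteq> {a..b}" using \<open>a < b\<close> by (auto simp: t_def)
      have int: "(\<lambda>s. F s (E s * apply_bcontfun w s)) integrable_on {t..b}" for w
        by (intro integrable_continuous_interval continuous_on_subset[OF contF t(2)]
            continuous_on_apply_bcontfun)
      \<comment> \<open>This is where the rate \<open>2 * L\<close> in \<open>E\<close> pays off:
        integrating \<open>L * E\<close> over \<open>{t..b}\<close> yields at most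
        \<open>E t / 2\<close>, hence the contraction factor \<open>1/2\<close>.\<close>
      have FTC: "((\<lambda>s. L * dist v w * E s) has_integral
          (- dist v w / 2 * E b) - (- dist v w / 2 * E t)) {t..b}"
        by (rule fundamental_theorem_of_calculus)
          (use t \<open>L > 0\<close> in \<open>auto intro!: derivative_eq_intros
            simp: E_def has_real_derivative_iff_has_vector_derivative[symmetric] algebra_simps\<close>)
      have "dist (P v x) (P w x) = inverse (E t) *
          \<bar>integral {t..b} (\<lambda>s. F s (E s * v s) - F s (E s * w s))\<bar>"
      proof -
        have "P v x - P w x = inverse (E t) * (integral {t..b} (\<lambda>s. F s (E s * w s)) -
            integral {t..b} (\<lambda>s. F s (E s * v s)))"
          unfolding P t_def[symmetric] G_def by (simp add: right_diff_distrib)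
        also have "\<bar>\<dots>\<bar> = inverse (E t) * \<bar>integral {t..b} (\<lambda>s. F s (E s * v s)) -
            integral {t..b} (\<lambda>s. F s (E s * w s))\<bar>"
          by (simp add: abs_mult E_def abs_minus_commute)
        finally show ?thesis
          by (simp only: dist_real_def Henstock_Kurzweil_Integration.integral_diff[OF int int])
      qed
      also have "\<dots> \<le> inverse (E t) * integral {t..b} (\<lambda>s. L * dist v w * E s)"
      proof (rule mult_left_mono)
        show "\<bar>integral {t..b} (\<lambda>s. F s (E s * v s) - F s (E s * w s))\<bar>
            \<le> integral {t..b} (\<lambda>s. L * dist v w * E s)"
          unfolding real_norm_def[symmetric]
        proof (rule integral_norm_bound_integral)
          show "(\<lambda>s. F s (E s * v s) - F s (E s * w s)) integrable_on {t..b}"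
            by (intro integrable_diff int)
          show "(\<lambda>s. L * dist v w * E s) integrable_on {t..b}"
            using FTC by (rule has_integral_integrable)
          fix s assume "s \<in> {t..b}"
          then have "\<bar>F s (E s * v s) - F s (E s * w s)\<bar> \<le> L * \<bar>E s * v s - E s * w s\<bar>"
            using lip t(2) by blast
          also have "\<bar>E s * v s - E s * w s\<bar> = E s * dist (v s) (w s)"
            by (simp add: dist_real_def E_def abs_mult flip: right_diff_distrib)
          also have "\<dots> \<le> E s * dist v w"
            by (intro mult_left_mono dist_bounded) (simp add: E_def)
          finally show "norm (F s (E s * v s) - F s (E s * w s)) \<le> L * dist v w * E s"
            using \<open>L > 0\<close> by (simp add: algebra_simps)
        qed
      qed (simp add: E_def)
      also have "integral {t..b} (\<lambda>s. L * dist v w * E s) \<le> dist v w / 2 * E t"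
        using FTC by (subst integral_unique) (auto simp: E_def)
      finally show "dist (P v x) (P w x) \<le> 1/2 * dist v w"
        by (simp add: E_def exp_minus field_simps)
    qed
  qed auto
  then obtain w where w: "P w = w" by auto
  define y where "y v = E v * apply_bcontfun w v" for v
  have y: "y v = yb - integral {v..b} (\<lambda>s. F s (y s))" if "v \<in> {a..b}" for v
  proof -
    have "apply_bcontfun w v = G (apply_bcontfun w) v"
      using P[of w v] w that by simp
    then have "y v = E v * G (apply_bcontfun w) v" by (simp add: y_def)
    then show ?thesis unfolding G_def y_def[symmetric] by (simp add: E_def)
  qed
  have "continuous_on {a..b} (\<lambda>s. F s (y s))"
    unfolding y_def by (rule contF) auto
  note der = integral_has_real_derivative'[OF this]
  show ?thesis
  proof (intro exI conjI ballI)
    show "y b = yb" using y[of b] \<open>a < b\<close> by simp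
    fix s assume s: "s \<in> {a..b}"
    have "((\<lambda>v. yb - integral {v..b} (\<lambda>s. F s (y s))) has_real_derivative F s (y s)) (at s within {a..b})"
      using der[OF s] by (auto intro!: derivative_eq_intros)
    then show "(y has_real_derivative F s (y s)) (at s within {a..b})"
      by (rule has_field_derivative_transform_within[OF _ zero_less_one]) (use s y in auto)
  qed
qed

section \<open>Positive solutions on compact intervals\<close>

text \<open>Here \<open>y\<close> stands for minus the flux as a function of the wave value, and
  \<open>r\<close> for \<open>1 / (p - 1)\<close>. Positivity is required up to the endpoints, to
  stay away from the singularity of \<open>y powr (- r)\<close>; \<open>h\<close> is a parameter so
  that profiles of different speeds can be compared.\<close>

definition profile_on ::
    "real \<Rightarrow> (real \<Rightarrow> real) \<Rightarrow> (real \<Rightarrow> real) \<Rightarrow> real \<Rightarrow> real \<Rightarrow> (real \<Rightarrow> real) \<Rightarrow> bool" where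
  "profile_on r h D a b y \<longleftrightarrow> continuous_on {a..b} y \<and> (\<forall>x\<in>{a..b}. 0 < y x) \<and>
     (\<forall>x\<in>{a<..<b}. (y has_real_derivative h x - D x * y x powr (- r)) (at x))"

lemma profile_on_subset:
  "profile_on r h D a b y \<Longrightarrow> a \<le> a' \<Longrightarrow> b' \<le> b \<Longrightarrow> profile_on r h D a' b' y"
  unfolding profile_on_def by (auto intro: continuous_on_subset)

lemma powr_minus_ge_near_zero:
  fixes r m K :: real
  assumes "r > 0" "m > 0"
  shows "\<exists>\<eta>>0. \<forall>y. 0 < y \<longrightarrow> y \<le> \<eta> \<longrightarrow> K \<le> m * y powr (- r)"
proof (intro exI conjI allI impI)
  \<comment> \<open>Chosen such that \<open>m * ?\<eta> powr (- r)\<close> equals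
    \<open>\<bar>K\<bar> + 1\<close>, which is positive for every \<open>K\<close>.\<close>
  let ?\<eta> = "(m / (\<bar>K\<bar> + 1)) powr (1 / r)"
  have pos: "m / (\<bar>K\<bar> + 1) > 0" using \<open>m > 0\<close> by (intro divide_pos_pos) auto
  then show "?\<eta> > 0" using powr_gt_zero less_irrefl by metis
  fix y assume y: "0 < y" "y \<le> ?\<eta>"
  have "\<bar>K\<bar> + 1 = m * ?\<eta> powr (- r)"
    using pos \<open>r > 0\<close> \<open>m > 0\<close> by (simp add: powr_powr powr_minus)
  also have "\<dots> \<le> m * y powr (- r)"
    using y \<open>r > 0\<close> \<open>m > 0\<close> by (intro mult_left_mono powr_mono2') auto
  finally show "K \<le> m * y powr (- r)" by linarith
qed

lemma powr_minus_lipschitz: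
  fixes r \<eta> x y :: real
  assumes "r > 0" "\<eta> > 0" "x \<ge> \<eta>" "y \<ge> \<eta>"
  shows "\<bar>x powr (- r) - y powr (- r)\<bar> \<le> r * \<eta> powr (- r - 1) * \<bar>x - y\<bar>"
proof -
  have "norm (x powr (- r) - y powr (- r)) \<le> r * \<eta> powr (- r - 1) * norm (x - y)"
  proof (rule field_differentiable_bound[of "{\<eta>..}"])
    fix z assume z: "z \<in> {\<eta>..}"
    show "((\<lambda>z. z powr (- r)) has_field_derivative (- r) * z powr (- r - 1)) (at z within {\<eta>..})"
      using z \<open>\<eta> > 0\<close> by (intro has_real_derivative_powr[THEN has_field_derivative_at_within]) auto
    show "norm (- r * z powr (- r - 1)) \<le> r * \<eta> powr (- r - 1)"
      using z assms by (auto simp: abs_mult intro!: powr_mono2')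
  qed (use assms in auto)
  then show ?thesis by simp
qed

text \<open>Below a small level the singular term forces slopes of at most \<open>-1\<close>, so a
  profile under the line \<open>\<kappa> * (b - x)\<close> would stay under it up to
  \<open>b\<close>, where the line vanishes but the profile is positive. The constant is the same
  for all profiles, as the passage to a limit of profiles requires.\<close>

lemma profile_on_lower_bound:
  assumes "r > 0" "a < b" "m > 0"
    and D: "\<And>x. x \<in> {a..b} \<Longrightarrow> m \<le> D x" and h: "\<And>x. x \<in> {a..b} \<Longrightarrow> h x \<le> H"
  shows "\<exists>\<kappa>>0. \<forall>y. profile_on r h D a b y \<longrightarrow> (\<forall>x\<in>{a..b}. \<kappa> * (b - x) \<le> y x)"
proof -
  obtain \<eta> where \<eta>: "\<eta> > 0" "\<And>y. 0 < y \<Longrightarrow> y \<le> \<eta> \<Longrightarrow> H + 1 \<le> m * y powr (- r)"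
    using powr_minus_ge_near_zero[OF \<open>r > 0\<close> \<open>m > 0\<close>] by metis
  \<comment> \<open>\<open>\<kappa> \<le> 1\<close> makes the line no steeper than the forced slope,
    and \<open>\<kappa> * (b - a) \<le> \<eta>\<close> keeps the line in the region where that slope
    is forced.\<close>
  define \<kappa> where "\<kappa> = min 1 (\<eta> / (b - a))"
  have \<kappa>: "\<kappa> > 0" "\<kappa> \<le> 1" "\<kappa> * (b - a) \<le> \<eta>"
    using \<open>a < b\<close> \<open>\<eta> > 0\<close> by (auto simp: \<kappa>_def min_def field_simps)
  show ?thesis
  proof (intro exI conjI allI impI ballI)
    fix y x assume y: "profile_on r h D a b y" and x: "x \<in> {a..b}"
    show "\<kappa> * (b - x) \<le> y x"
    proof (rule ccontr)
      assume "\<not> ?thesis"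
      then have pos: "0 < \<kappa> * (b - x) - y x" by simp
      have "\<kappa> * (b - x) - y x \<le> \<kappa> * (b - b) - y b"
      proof (rule DERIV_nonneg_while_pos_imp_nondecreasing[of x b "\<lambda>x. \<kappa> * (b - x) - y x"])
        show "continuous_on {x..b} (\<lambda>x. \<kappa> * (b - x) - y x)"
          using y x unfolding profile_on_def by (auto intro!: continuous_intros continuous_on_subset[of "{a..b}" y])
        fix z assume z: "x < z" "z < b" "0 < \<kappa> * (b - z) - y z"
        have "\<kappa> * (b - z) \<le> \<kappa> * (b - a)" using z x \<kappa>(1) by auto
        then have "y z \<le> \<eta>" "0 < y z" using z x \<kappa>(3) y by (auto simp: profile_on_def)
        then have "H + 1 \<le> m * y z powr (- r)" by (intro \<eta>)
        also have "\<dots> \<le> D z * y z powr (- r)" using D[of z] z x by (intro mult_right_mono) auto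
        finally have "h z - D z * y z powr (- r) \<le> - 1" using h[of z] z x by auto
        then show "\<exists>m. ((\<lambda>x. \<kappa> * (b - x) - y x) has_real_derivative m) (at z) \<and> 0 \<le> m"
          using y z x \<kappa>
          by (intro exI[of _ "- \<kappa> - (h z - D z * y z powr (- r))"])
            (auto simp: profile_on_def intro!: derivative_eq_intros)
      qed (use x pos in auto)
      moreover have "y b > 0" using y x by (auto simp: profile_on_def)
      ultimately show False using pos by simp
    qed
  qed (use \<kappa> in auto)
qed

text \<open>Near \<open>0\<close> the slope of \<open>y\<close> is nonpositive, so as
  \<open>x\<close> decreases from \<open>b\<close> the solution cannot sink into the singularity,
  and it extends over the whole interval.\<close>

lemma profile_on_exists:
  assumes "r > 0" "a < b" "yb > 0"
    and D: "continuous_on {a..b} D" "\<And>x. x \<in> {a..b} \<Longrightarrow> D x > 0" and h: "continuous_on {a..b} h"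
  shows "\<exists>y. profile_on r h D a b y \<and> y b = yb"
proof -
  obtain m where m: "m > 0" "\<And>x. x \<in> {a..b} \<Longrightarrow> m \<le> D x"
    using continuous_attains_inf[of "{a..b}" D] D \<open>a < b\<close>
    by (metis atLeastAtMost_iff compact_Icc empty_iff less_eq_real_def)
  obtain M where M: "\<And>x. x \<in> {a..b} \<Longrightarrow> D x \<le> M"
    using continuous_attains_sup[of "{a..b}" D] D(1) \<open>a < b\<close>
    by (metis atLeastAtMost_iff compact_Icc empty_iff less_eq_real_def)
  have "M > 0" using m(1) m(2)[of a] M[of a] \<open>a < b\<close> by auto
  obtain H where H: "\<And>x. x \<in> {a..b} \<Longrightarrow> h x \<le> H"
    using continuous_attains_sup[of "{a..b}" h] h \<open>a < b\<close>
    by (metis atLeastAtMost_iff compact_Icc empty_iff less_eq_real_def)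
  obtain \<eta>' where \<eta>': "\<eta>' > 0" "\<And>y. 0 < y \<Longrightarrow> y \<le> \<eta>' \<Longrightarrow> H \<le> m * y powr (- r)"
    using powr_minus_ge_near_zero[OF \<open>r > 0\<close> m(1)] by metis
  \<comment> \<open>The minimum with \<open>yb\<close> makes the barrier hold at \<open>b\<close>;
    \<open>\<eta> \<le> \<eta>'\<close> makes the truncated slope nonpositive below
    \<open>\<eta>\<close>.\<close>
  define \<eta> where "\<eta> = min \<eta>' yb"
  have \<eta>: "\<eta> > 0" "\<eta> \<le> yb" "H \<le> m * \<eta> powr (- r)"
    using \<eta>' \<open>yb > 0\<close> by (auto simp: \<eta>_def)
  \<comment> \<open>Truncating at \<open>\<eta>\<close> removes the singularity, and \<open>\<eta>\<close> itself is a lower barrier.\<close>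
  define F where "F s y = h s - D s * max y \<eta> powr (- r)" for s y
  define L where "L = M * (r * \<eta> powr (- r - 1))"
  have "\<exists>y. y b = yb \<and> (\<forall>s\<in>{a..b}. (y has_real_derivative F s (y s)) (at s within {a..b}))"
  proof (rule lipschitz_terminal_value_problem)
    show "L > 0" using \<open>M > 0\<close> \<open>r > 0\<close> \<eta>(1) by (simp add: L_def)
    show "continuous_on {a..b} (\<lambda>s. F s (w s))" if "continuous_on {a..b} w" for w
      unfolding F_def using \<eta>(1) by (intro continuous_intros h D that) auto
    show "\<bar>F s x - F s y\<bar> \<le> L * \<bar>x - y\<bar>" if s: "s \<in> {a..b}" for s x y
    proof -
      have "\<bar>F s x - F s y\<bar> = D s * \<bar>max x \<eta> powr (- r) - max y \<eta> powr (- r)\<bar>"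
        using D(2)[OF s] by (simp add: F_def abs_mult abs_minus_commute flip: right_diff_distrib)
      also have "\<dots> \<le> M * (r * \<eta> powr (- r - 1) * \<bar>max x \<eta> - max y \<eta>\<bar>)"
        using M[OF s] D(2)[OF s] \<open>r > 0\<close> \<eta>(1)
        by (intro mult_mono powr_minus_lipschitz) auto
      also have "\<dots> \<le> M * (r * \<eta> powr (- r - 1) * \<bar>x - y\<bar>)"
        using \<open>M > 0\<close> \<open>r > 0\<close> by (intro mult_left_mono) auto
      finally show ?thesis by (simp add: L_def mult.assoc)
    qed
  qed fact
  then obtain y where yb: "y b = yb"
    and der: "\<And>s. s \<in> {a..b} \<Longrightarrow> (y has_real_derivative F s (y s)) (at s within {a..b})"
    by auto
  have conty: "continuous_on {a..b} y"
    unfolding continuous_on_eq_continuous_within by (intro ballI DERIV_continuous[OF der])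
  have der': "(y has_real_derivative F s (y s)) (at s)" if "s \<in> {a<..<b}" for s
    using der[of s] that by (simp add: at_within_Icc_at)
  have lower: "\<eta> \<le> y x" if x: "x \<in> {a..b}" for x
  proof (rule ccontr)
    assume "\<not> \<eta> \<le> y x"
    then have pos: "\<eta> - y x > 0" by simp
    have "\<eta> - y x \<le> \<eta> - y b"
    proof (rule DERIV_nonneg_while_pos_imp_nondecreasing[of x b "\<lambda>x. \<eta> - y x"])
      show "continuous_on {x..b} (\<lambda>x. \<eta> - y x)"
        using x by (auto intro!: continuous_intros continuous_on_subset[OF conty])
      fix z assume z: "x < z" "z < b" "0 < \<eta> - y z"
      have "h z \<le> m * \<eta> powr (- r)" using H[of z] \<eta>(3) z x by auto
      also have "\<dots> \<le> D z * \<eta> powr (- r)" using m(2)[of z] z x by (intro mult_right_mono) auto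
      finally have "F z (y z) \<le> 0" using z by (simp add: F_def max_def)
      then show "\<exists>m. ((\<lambda>x. \<eta> - y x) has_real_derivative m) (at z) \<and> 0 \<le> m"
        using der'[of z] z x by (intro exI[of _ "- F z (y z)"]) (auto intro!: derivative_eq_intros)
    qed (use x pos in auto)
    then show False using pos yb \<eta>(2) by simp
  qed
  have "profile_on r h D a b y"
    unfolding profile_on_def
  proof (intro conjI ballI)
    show "y x > 0" if "x \<in> {a..b}" for x using lower[OF that] \<eta>(1) by simp
    show "(y has_real_derivative h x - D x * y x powr (- r)) (at x)" if "x \<in> {a<..<b}" for x
      using der'[OF that] lower[of x] that by (simp add: F_def max_def split: if_splits)
  qed (rule conty)
  with yb show ?thesis by blast
qed

text \<open>Where \<open>y > z\<close> the singular term of \<open>y\<close> is the smaller one, so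
  \<open>y' - z' \<ge> - \<kappa>\<close>. Hence the excess of \<open>y - z\<close> over the claimed
  bound is nondecreasing while it is positive, but at \<open>b\<close> it is at most
  \<open>0\<close>.\<close>

lemma profile_on_le_add:
  assumes "r > 0" "x \<in> {a..b}" and y: "profile_on r h D a b y" and z: "profile_on r k D a b z"
    and D: "\<And>x. x \<in> {a..b} \<Longrightarrow> D x > 0"
    and \<kappa>: "\<kappa> \<ge> 0" "\<And>x. x \<in> {a..b} \<Longrightarrow> \<bar>h x - k x\<bar> \<le> \<kappa>"
  shows "y x - z x \<le> max 0 (y b - z b) + \<kappa> * (b - x)"
proof (rule ccontr)
  define \<phi> where "\<phi> v = y v - z v - max 0 (y b - z b) - \<kappa> * (b - v)" for v
  assume "\<not> ?thesis"
  then have pos: "\<phi> x > 0" by (simp add: \<phi>_def)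
  have "\<phi> x \<le> \<phi> b"
  proof (rule DERIV_nonneg_while_pos_imp_nondecreasing[of x b \<phi>])
    have "continuous_on {a..b} \<phi>" unfolding \<phi>_def
      using y z by (auto simp: profile_on_def intro!: continuous_intros)
    then show "continuous_on {x..b} \<phi>" using \<open>x \<in> {a..b}\<close> by (auto intro: continuous_on_subset)
    fix v assume v: "x < v" "v < b" "\<phi> v > 0"
    have v': "v \<in> {a..b}" "v \<in> {a<..<b}" using v \<open>x \<in> {a..b}\<close> by auto
    have "0 \<le> \<kappa> * (b - v)" using v \<kappa>(1) by simp
    then have "z v < y v" using v by (auto simp: \<phi>_def)
    moreover have "z v > 0" using z v' by (simp add: profile_on_def)
    ultimately have "y v powr (- r) \<le> z v powr (- r)"
      using \<open>r > 0\<close> by (intro powr_mono2') auto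
    then have "D v * y v powr (- r) \<le> D v * z v powr (- r)"
      using D[OF v'(1)] by simp
    moreover have "\<bar>h v - k v\<bar> \<le> \<kappa>" by (rule \<kappa>(2)[OF v'(1)])
    moreover have "(\<phi> has_real_derivative (h v - D v * y v powr (- r)) - (k v - D v * z v powr (- r)) + \<kappa>) (at v)"
      unfolding \<phi>_def using y z v' by (auto simp: profile_on_def intro!: derivative_eq_intros)
    ultimately show "\<exists>m. (\<phi> has_real_derivative m) (at v) \<and> 0 \<le> m"
      by (intro exI conjI) (assumption, linarith)
  qed (use assms(2) pos in auto)
  then show False using pos by (simp add: \<phi>_def)
qed

text \<open>Backwards in \<open>x\<close> the equation is dissipative, because its right-hand side increases in \<open>y\<close>.\<close>

lemma profile_on_diff_le:
  assumes "r > 0" "x \<in> {a..b}" and y: "profile_on r h D a b y" and z: "profile_on r k D a b z"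
    and D: "\<And>x. x \<in> {a..b} \<Longrightarrow> D x > 0"
    and \<kappa>: "\<kappa> \<ge> 0" "\<And>x. x \<in> {a..b} \<Longrightarrow> \<bar>h x - k x\<bar> \<le> \<kappa>"
  shows "\<bar>y x - z x\<bar> \<le> \<bar>y b - z b\<bar> + \<kappa> * (b - x)"
proof -
  have "y x - z x \<le> max 0 (y b - z b) + \<kappa> * (b - x)"
    by (rule profile_on_le_add[OF assms])
  moreover have "z x - y x \<le> max 0 (z b - y b) + \<kappa> * (b - x)"
    by (rule profile_on_le_add[OF assms(1,2) z y D \<kappa>(1)]) (use \<kappa>(2) in \<open>auto simp: abs_minus_commute\<close>)
  ultimately show ?thesis by linarith
qed

section \<open>Profiles on the open unit interval and their perturbation\<close>

text \<open>Boundary values are left out: a perturbed profile is constructed first, and its limits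
  at \<open>0\<close> and \<open>1\<close> are found afterwards from estimates.\<close>

definition unit_profile :: "real \<Rightarrow> (real \<Rightarrow> real) \<Rightarrow> (real \<Rightarrow> real) \<Rightarrow> (real \<Rightarrow> real) \<Rightarrow> bool" where
  "unit_profile r h D y \<longleftrightarrow>
     (\<forall>x\<in>{0<..<1}. 0 < y x \<and> (y has_real_derivative h x - D x * y x powr (- r)) (at x))"

lemma unit_profile_continuous_on:
  "unit_profile r h D y \<Longrightarrow> continuous_on {0<..<1} y"
  unfolding unit_profile_def by (metis DERIV_isCont continuous_at_imp_continuous_on)

lemma unit_profile_imp_profile_on:
  assumes "unit_profile r h D y" "0 < a" "b < 1"
  shows "profile_on r h D a b y"
proof -
  have "continuous_on {a..b} y"
    by (rule continuous_on_subset[OF unit_profile_continuous_on[OF assms(1)]]) (use assms in auto)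
  then show ?thesis using assms by (auto simp: profile_on_def unit_profile_def)
qed

lemma uniform_limit_imp_has_real_derivative:
  fixes f f' :: "nat \<Rightarrow> real \<Rightarrow> real"
  assumes "open S" "convex S" and x: "x \<in> S"
    and der: "\<And>n x. x \<in> S \<Longrightarrow> (f n has_real_derivative f' n x) (at x)"
    and unif: "uniform_limit S f' g' sequentially"
    and lim: "\<And>x. x \<in> S \<Longrightarrow> (\<lambda>n. f n x) \<longlonglongrightarrow> g x"
  shows "(g has_real_derivative g' x) (at x)"
proof -
  have "\<exists>G. \<forall>x\<in>S. (\<lambda>n. f n x) \<longlonglongrightarrow> G x \<and> (G has_derivative (\<lambda>t. g' x * t)) (at x within S)"
  proof (rule has_derivative_sequence[where f = f and f' = "\<lambda>n x t. f' n x * t" and ?x0.0 = x and l = "g x"])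
    show "(f n has_derivative (\<lambda>t. f' n x * t)) (at x within S)" if "x \<in> S" for n x
      using der[OF that, of n] by (auto simp: has_field_derivative_def intro: has_derivative_at_withinI)
    fix e :: real assume "e > 0"
    from uniform_limitD[OF unif this]
    show "\<forall>\<^sub>F n in sequentially. \<forall>x\<in>S. \<forall>t. norm (f' n x * t - g' x * t) \<le> e * norm t"
    proof eventually_elim
      case (elim n)
      have "norm (f' n x * t - g' x * t) = \<bar>f' n x - g' x\<bar> * \<bar>t\<bar>" for x t
        by (simp add: abs_mult flip: left_diff_distrib)
      moreover have "\<bar>f' n x - g' x\<bar> \<le> e" if "x \<in> S" for x
        using elim that by (auto simp: dist_real_def intro: less_imp_le)
      ultimately show ?case by (auto intro!: mult_right_mono)
    qed
  qed (use assms in auto)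
  then obtain G where G: "\<And>x. x \<in> S \<Longrightarrow> (\<lambda>n. f n x) \<longlonglongrightarrow> G x"
      "\<And>x. x \<in> S \<Longrightarrow> (G has_derivative (\<lambda>t. g' x * t)) (at x within S)"
    by auto
  have eq: "G x = g x" if "x \<in> S" for x
    using LIMSEQ_unique[OF G(1)[OF that] lim[OF that]] .
  have "(G has_real_derivative g' x) (at x)"
    using G(2)[OF x] at_within_open[OF x \<open>open S\<close>] by (simp add: has_field_derivative_def)
  then show ?thesis
    by (rule has_field_derivative_transform_within_open[OF _ \<open>open S\<close> x]) (rule eq)
qed

text \<open>The perturbed equation is solved backwards on \<open>{a n..b n}\<close> from the value
  of \<open>y\<close> at \<open>b n\<close>. Dissipativity keeps these solutions near
  \<open>y\<close> and makes them Cauchy, and a common positive lower bound lets the singular term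
  pass to the limit. The factor \<open>1 - x\<close> in the estimate preserves a limit at
  \<open>1\<close>.\<close>

lemma unit_profile_perturb:
  assumes "r > 0" and contD: "continuous_on {0<..<1} D" and D: "\<And>x. x \<in> {0<..<1} \<Longrightarrow> D x > 0"
    and contk: "continuous_on {0<..<1} k" and y: "unit_profile r h D y"
    and "\<kappa> \<ge> 0" and \<kappa>: "\<And>x. x \<in> {0<..<1} \<Longrightarrow> \<bar>h x - k x\<bar> \<le> \<kappa>"
  shows "\<exists>z. unit_profile r k D z \<and> (\<forall>x\<in>{0<..<1}. \<bar>z x - y x\<bar> \<le> \<kappa> * (1 - x))"
proof -
  \<comment> \<open>The summand \<open>3\<close> gives \<open>a n < b n\<close> already for
    \<open>n = 0\<close>; with \<open>2\<close> both would be \<open>1/2\<close>.\<close>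
  define a where "a n = 1 / (real n + 3)" for n :: nat
  define b where "b n = 1 - 1 / (real n + 3)" for n :: nat
  have ab: "0 < a n" "a n < b n" "b n < 1" for n by (auto simp: a_def b_def field_simps)
  have a_mono: "a m \<le> a n" and b_mono: "b n \<le> b m" if "n \<le> m" for n m
    using that by (auto simp: a_def b_def frac_le)
  have lim_a: "a \<longlonglongrightarrow> 0"
    using LIMSEQ_ignore_initial_segment[OF lim_1_over_n, of 3]
    by (simp add: a_def[abs_def])
  have lim_b: "b \<longlonglongrightarrow> 1"
    using tendsto_diff[OF tendsto_const lim_a, of 1] by (simp add: a_def[abs_def] b_def[abs_def])
  have sub: "{a n..b n} \<subseteq> {0<..<1}" for n using ab[of n] by auto
  have "\<exists>z. profile_on r k D (a n) (b n) z \<and> z (b n) = y (b n)" for n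
  proof (rule profile_on_exists[OF \<open>r > 0\<close> ab(2)])
    show "0 < y (b n)" using y ab[of n] by (auto simp: unit_profile_def)
    show "continuous_on {a n..b n} D" "continuous_on {a n..b n} k"
      using continuous_on_subset[OF contD sub] continuous_on_subset[OF contk sub] by auto
    show "D x > 0" if "x \<in> {a n..b n}" for x using D sub[of n] that by blast
  qed
  then obtain Z where Z: "\<And>n. profile_on r k D (a n) (b n) (Z n)" "\<And>n. Z n (b n) = y (b n)"
    by metis
  have close: "\<bar>Z n x - y x\<bar> \<le> \<kappa> * (b n - x)" if x: "x \<in> {a n..b n}" for n x
  proof -
    have "\<bar>Z n x - y x\<bar> \<le> \<bar>Z n (b n) - y (b n)\<bar> + \<kappa> * (b n - x)"
    proof (rule profile_on_diff_le[OF \<open>r > 0\<close> x Z(1) unit_profile_imp_profile_on[OF y ab(1,3)] _ \<open>\<kappa> \<ge> 0\<close>])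
      show "D x > 0" if "x \<in> {a n..b n}" for x using D sub[of n] that by blast
      show "\<bar>k x - h x\<bar> \<le> \<kappa>" if "x \<in> {a n..b n}" for x
        using \<kappa>[of x] sub[of n] that by (auto simp: abs_minus_commute)
    qed
    then show ?thesis by (simp add: Z(2))
  qed
  \<comment> \<open>\<open>Z m\<close> and \<open>Z n\<close> solve the same equation, so their
    distance is controlled by its value at \<open>b n\<close>. There \<open>Z n\<close> agrees with
    \<open>y\<close>, while \<open>Z m\<close> has drifted away from \<open>y\<close> only between
    \<open>b n\<close> and \<open>b m\<close>.\<close>
  have cauchy: "\<bar>Z m x - Z n x\<bar> \<le> \<kappa> * (1 - b n)" if "n \<le> m" and x: "x \<in> {a n..b n}" for m n x
  proof -
    have "\<bar>Z m x - Z n x\<bar> \<le> \<bar>Z m (b n) - Z n (b n)\<bar> + 0 * (b n - x)"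
    proof (rule profile_on_diff_le[OF \<open>r > 0\<close> x _ Z(1)])
      show "profile_on r k D (a n) (b n) (Z m)"
        using profile_on_subset[OF Z(1) a_mono b_mono] \<open>n \<le> m\<close> by blast
      show "D x > 0" if "x \<in> {a n..b n}" for x using D sub[of n] that by blast
    qed auto
    also have "\<bar>Z m (b n) - Z n (b n)\<bar> \<le> \<kappa> * (b m - b n)"
      using close[of "b n" m] a_mono[OF \<open>n \<le> m\<close>] b_mono[OF \<open>n \<le> m\<close>] ab[of n] by (simp add: Z(2))
    also have "\<dots> \<le> \<kappa> * (1 - b n)"
      using ab(3)[of m] \<open>\<kappa> \<ge> 0\<close> by (intro mult_left_mono) auto
    finally show ?thesis by simp
  qed
  have inside: "\<forall>\<^sub>F n in sequentially. x \<in> {a n<..<b n}" if "x \<in> {0<..<1}" for x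
  proof -
    have "\<forall>\<^sub>F n in sequentially. a n < x" using order_tendstoD(2)[OF lim_a] that by auto
    moreover have "\<forall>\<^sub>F n in sequentially. x < b n" using order_tendstoD(1)[OF lim_b] that by auto
    ultimately show ?thesis by eventually_elim auto
  qed
  have lim_err: "(\<lambda>n. \<kappa> * (1 - b n)) \<longlonglongrightarrow> 0"
    using tendsto_mult[OF tendsto_const tendsto_diff[OF tendsto_const lim_b], of \<kappa> 1] by simp
  define z where "z x = lim (\<lambda>n. Z n x)" for x
  have lim_z: "(\<lambda>n. Z n x) \<longlonglongrightarrow> z x" if x: "x \<in> {0<..<1}" for x
  proof -
    have "Cauchy (\<lambda>n. Z n x)"
    proof (rule metric_CauchyI)
      fix e :: real assume "e > 0"
      then have "\<forall>\<^sub>F n in sequentially. \<kappa> * (1 - b n) < e / 2"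
        using order_tendstoD(2)[OF lim_err, of "e / 2"] by auto
      then have "\<forall>\<^sub>F n in sequentially. \<kappa> * (1 - b n) < e / 2 \<and> x \<in> {a n<..<b n}"
        using inside[OF x] by (rule eventually_conj)
      then obtain N where N: "\<kappa> * (1 - b N) < e / 2" "x \<in> {a N<..<b N}"
        using eventually_happens'[OF sequentially_bot] by blast
      have "\<bar>Z m x - Z n x\<bar> < e" if "m \<ge> N" "n \<ge> N" for m n
        using cauchy[OF that(1), of x] cauchy[OF that(2), of x] N by auto
      then show "\<exists>M. \<forall>m\<ge>M. \<forall>n\<ge>M. dist (Z m x) (Z n x) < e" by (auto simp: dist_real_def)
    qed
    then show ?thesis by (simp add: z_def Cauchy_convergent_iff convergent_LIMSEQ_iff)
  qed
  have unif: "\<bar>Z n x - z x\<bar> \<le> \<kappa> * (1 - b n)" if "x \<in> {a n..b n}" for n x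
  proof (rule LIMSEQ_le_const2)
    show "(\<lambda>m. \<bar>Z n x - Z m x\<bar>) \<longlonglongrightarrow> \<bar>Z n x - z x\<bar>"
      using sub[of n] that by (intro tendsto_intros lim_z) auto
    show "\<exists>N. \<forall>m\<ge>N. \<bar>Z n x - Z m x\<bar> \<le> \<kappa> * (1 - b n)"
      using cauchy[OF _ that] by (auto simp: abs_minus_commute)
  qed
  have bound: "\<bar>z x - y x\<bar> \<le> \<kappa> * (1 - x)" if x: "x \<in> {0<..<1}" for x
  proof (rule tendsto_upperbound)
    show "(\<lambda>n. \<bar>Z n x - y x\<bar>) \<longlonglongrightarrow> \<bar>z x - y x\<bar>" by (intro tendsto_intros lim_z x)
    show "\<forall>\<^sub>F n in sequentially. \<bar>Z n x - y x\<bar> \<le> \<kappa> * (1 - x)"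
      using inside[OF x]
    proof eventually_elim
      case (elim n)
      then have "\<bar>Z n x - y x\<bar> \<le> \<kappa> * (b n - x)" by (intro close) auto
      also have "\<dots> \<le> \<kappa> * (1 - x)" using ab(3)[of n] \<open>\<kappa> \<ge> 0\<close> by (intro mult_left_mono) auto
      finally show ?case .
    qed
  qed simp
  have "unit_profile r k D z"
    unfolding unit_profile_def
  proof
    fix x0 :: real assume x0: "x0 \<in> {0<..<1}"
    obtain N where N: "x0 \<in> {a N<..<b N}"
      using eventually_happens'[OF sequentially_bot inside[OF x0]] by blast
    define S where "S = {a N<..<b N}"
    have lt: "b N < b (Suc N)" by (simp add: b_def field_simps)
    have sub': "{a N..b (Suc N)} \<subseteq> {0<..<1}" using ab[of N] ab[of "Suc N"] by auto
    have ne: "{a N..b (Suc N)} \<noteq> {}" using ab[of N] lt by auto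
    obtain m where m: "m > 0" "\<And>x. x \<in> {a N..b (Suc N)} \<Longrightarrow> m \<le> D x"
      using continuous_attains_inf[OF compact_Icc ne continuous_on_subset[OF contD sub']] D sub' by blast
    obtain M where M: "\<And>x. x \<in> {a N..b (Suc N)} \<Longrightarrow> D x \<le> M"
      using continuous_attains_sup[OF compact_Icc ne continuous_on_subset[OF contD sub']] by blast
    obtain H where H: "\<And>x. x \<in> {a N..b (Suc N)} \<Longrightarrow> k x \<le> H"
      using continuous_attains_sup[OF compact_Icc ne continuous_on_subset[OF contk sub']] by blast
    have "a N < b (Suc N)" using ab(2)[of N] lt by linarith
    from profile_on_lower_bound[of r _ _ m D k H, OF \<open>r > 0\<close> this m H] obtain \<gamma> where "\<gamma> > 0"
      and \<gamma>: "\<forall>y. profile_on r k D (a N) (b (Suc N)) y \<longrightarrow>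
        (\<forall>x\<in>{a N..b (Suc N)}. \<gamma> * (b (Suc N) - x) \<le> y x)" by blast
    \<comment> \<open>The barrier vanishes at the right end of its interval. Using it up to
      \<open>b (Suc N)\<close> leaves a positive bound on \<open>S\<close>, which ends at
      \<open>b N\<close>.\<close>
    define \<eta> where "\<eta> = \<gamma> * (b (Suc N) - b N)"
    have "\<eta> > 0" using lt \<open>\<gamma> > 0\<close> by (simp add: \<eta>_def)
    have lower: "\<eta> \<le> Z n x" if "n \<ge> Suc N" "x \<in> S" for n x
    proof -
      have "\<eta> \<le> \<gamma> * (b (Suc N) - x)"
        unfolding \<eta>_def by (rule mult_left_mono) (use that \<open>\<gamma> > 0\<close> in \<open>auto simp: S_def\<close>)
      also have "\<dots> \<le> Z n x"
      proof (rule \<gamma>[rule_format])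
        show "profile_on r k D (a N) (b (Suc N)) (Z n)"
          by (rule profile_on_subset[OF Z(1)]) (use that a_mono[of N n] b_mono[of "Suc N" n] in auto)
      qed (use that lt in \<open>auto simp: S_def\<close>)
      finally show ?thesis .
    qed
    have S: "S \<subseteq> {0<..<1}" "S \<subseteq> {a N..b (Suc N)}" using ab[of N] lt by (auto simp: S_def)
    have lower_z: "\<eta> \<le> z x" if "x \<in> S" for x
    proof (rule LIMSEQ_le_const[OF lim_z])
      show "\<exists>N. \<forall>n\<ge>N. \<eta> \<le> Z n x" using lower[OF _ that] by blast
    qed (use that S in auto)
    \<comment> \<open>From index \<open>Suc N\<close> on, every \<open>Z n\<close> solves the
      equation around \<open>S\<close> and obeys the bound \<open>\<eta>\<close>; hence the shift.
      Above \<open>\<eta>\<close> the power is Lipschitz, so uniform convergence carries over to the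
      derivatives.\<close>
    have "(z has_real_derivative k x0 - D x0 * z x0 powr (- r)) (at x0)"
    proof (rule uniform_limit_imp_has_real_derivative[of S x0 "\<lambda>n. Z (n + Suc N)"
          "\<lambda>n x. k x - D x * Z (n + Suc N) x powr (- r)" "\<lambda>x. k x - D x * z x powr (- r)"])
      show "(Z (n + Suc N) has_real_derivative k x - D x * Z (n + Suc N) x powr (- r)) (at x)"
        if "x \<in> S" for n x
      proof -
        have "x \<in> {a (n + Suc N)<..<b (n + Suc N)}"
          using that a_mono[of N "n + Suc N"] b_mono[of N "n + Suc N"] by (auto simp: S_def)
        then show ?thesis using Z(1)[of "n + Suc N"] by (auto simp: profile_on_def)
      qed
      show "(\<lambda>n. Z (n + Suc N) x) \<longlonglongrightarrow> z x" if "x \<in> S" for x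
        by (rule LIMSEQ_ignore_initial_segment[OF lim_z]) (use S that in auto)
      define C where "C = M * (r * \<eta> powr (- r - 1))"
      show "uniform_limit S (\<lambda>n x. k x - D x * Z (n + Suc N) x powr (- r))
          (\<lambda>x. k x - D x * z x powr (- r)) sequentially"
      proof (rule uniform_limitI)
        fix e :: real assume "e > 0"
        have "(\<lambda>n. C * (\<kappa> * (1 - b (n + Suc N)))) \<longlonglongrightarrow> C * 0"
          by (rule tendsto_mult[OF tendsto_const LIMSEQ_ignore_initial_segment[OF lim_err]])
        then have "\<forall>\<^sub>F n in sequentially. C * (\<kappa> * (1 - b (n + Suc N))) < e"
          using order_tendstoD(2)[of _ 0 sequentially e] \<open>e > 0\<close> by simp
        then show "\<forall>\<^sub>F n in sequentially. \<forall>x\<in>S. dist (k x - D x * Z (n + Suc N) x powr (- r))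
            (k x - D x * z x powr (- r)) < e"
        proof eventually_elim
          case (elim n)
          show ?case
          proof
            fix x assume x: "x \<in> S"
            have xab: "x \<in> {a (n + Suc N)..b (n + Suc N)}"
              using x a_mono[of N "n + Suc N"] b_mono[of N "n + Suc N"] by (auto simp: S_def)
            have Dx: "0 < D x" "D x \<le> M" using D M S x by auto
            have "dist (k x - D x * Z (n + Suc N) x powr (- r)) (k x - D x * z x powr (- r)) =
                D x * \<bar>Z (n + Suc N) x powr (- r) - z x powr (- r)\<bar>"
              using Dx(1) by (simp add: dist_real_def abs_mult abs_minus_commute flip: right_diff_distrib)
            also have "\<dots> \<le> M * (r * \<eta> powr (- r - 1) * \<bar>Z (n + Suc N) x - z x\<bar>)"
              using Dx \<open>r > 0\<close> \<open>\<eta> > 0\<close> x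
              by (intro mult_mono powr_minus_lipschitz lower lower_z) auto
            also have "\<dots> \<le> M * (r * \<eta> powr (- r - 1) * (\<kappa> * (1 - b (n + Suc N))))"
              using Dx \<open>r > 0\<close> unif[OF xab] by (intro mult_left_mono) auto
            also have "\<dots> < e" using elim by (simp only: C_def mult.assoc)
            finally show "dist (k x - D x * Z (n + Suc N) x powr (- r)) (k x - D x * z x powr (- r)) < e" .
          qed
        qed
      qed
    qed (use N in \<open>auto simp: S_def\<close>)
    moreover have "0 < z x0" using lower_z[of x0] N \<open>\<eta> > 0\<close> by (auto simp: S_def)
    ultimately show "0 < z x0 \<and> (z has_real_derivative k x0 - D x0 * z x0 powr (- r)) (at x0)" by simp
  qed
  with bound show ?thesis by blast
qed

section \<open>Waves and profiles\<close>

text \<open>Expressing the one-sided filter of \<open>ereal\<close> by real times allows finite and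
  infinite endpoints to be treated alike from here on.\<close>

lemma eventually_at_left_einterval:
  assumes "\<alpha> < (\<beta>::ereal)"
  shows "eventually P (at_left \<beta>) \<longleftrightarrow>
    (\<exists>t\<in>einterval \<alpha> \<beta>. \<forall>s\<in>einterval \<alpha> \<beta>. t < s \<longrightarrow> P (ereal s))"
proof
  assume "eventually P (at_left \<beta>)"
  then obtain b where b: "b < \<beta>" "\<And>y. b < y \<Longrightarrow> y < \<beta> \<Longrightarrow> P y"
    using eventually_at_left[OF \<open>\<alpha> < \<beta>\<close>] by auto
  have "max \<alpha> b < \<beta>" using b(1) \<open>\<alpha> < \<beta>\<close> by simp
  then obtain t where t: "t \<in> einterval (max \<alpha> b) \<beta>" using einterval_nonempty by blast
  have "P (ereal s)" if "s \<in> einterval \<alpha> \<beta>" "t < s" for s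
  proof (rule b(2))
    have "b < ereal t" using t by (simp add: einterval_iff)
    also have "\<dots> < ereal s" using that by simp
    finally show "b < ereal s" .
  qed (use that in \<open>simp add: einterval_iff\<close>)
  moreover have "t \<in> einterval \<alpha> \<beta>" using t by (simp add: einterval_iff)
  ultimately show "\<exists>t\<in>einterval \<alpha> \<beta>. \<forall>s\<in>einterval \<alpha> \<beta>. t < s \<longrightarrow> P (ereal s)" by blast
next
  assume "\<exists>t\<in>einterval \<alpha> \<beta>. \<forall>s\<in>einterval \<alpha> \<beta>. t < s \<longrightarrow> P (ereal s)"
  then obtain t where t: "\<alpha> < ereal t" "ereal t < \<beta>"
      "\<And>s. s \<in> einterval \<alpha> \<beta> \<Longrightarrow> t < s \<Longrightarrow> P (ereal s)"
    by (auto simp: einterval_iff)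
  have "P y" if y: "ereal t < y" "y < \<beta>" for y
  proof (cases y)
    case (real s)
    then show ?thesis using t y less_trans[OF t(1) y(1)] by (auto simp: einterval_iff)
  qed (use y in auto)
  then show "eventually P (at_left \<beta>)"
    using eventually_at_left[OF \<open>\<alpha> < \<beta>\<close>] t(2) by blast
qed

lemma eventually_at_right_einterval:
  assumes "\<alpha> < (\<beta>::ereal)"
  shows "eventually P (at_right \<alpha>) \<longleftrightarrow>
    (\<exists>t\<in>einterval \<alpha> \<beta>. \<forall>s\<in>einterval \<alpha> \<beta>. s < t \<longrightarrow> P (ereal s))"
proof
  assume "eventually P (at_right \<alpha>)"
  then obtain b where b: "\<alpha> < b" "\<And>y. \<alpha> < y \<Longrightarrow> y < b \<Longrightarrow> P y"
    using eventually_at_right[OF \<open>\<alpha> < \<beta>\<close>] by auto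
  have "\<alpha> < min b \<beta>" using b(1) \<open>\<alpha> < \<beta>\<close> by simp
  then obtain t where t: "t \<in> einterval \<alpha> (min b \<beta>)" using einterval_nonempty by blast
  have "P (ereal s)" if "s \<in> einterval \<alpha> \<beta>" "s < t" for s
  proof (rule b(2))
    have "ereal s < ereal t" using that by simp
    also have "\<dots> < b" using t by (simp add: einterval_iff)
    finally show "ereal s < b" .
  qed (use that in \<open>simp add: einterval_iff\<close>)
  moreover have "t \<in> einterval \<alpha> \<beta>" using t by (simp add: einterval_iff)
  ultimately show "\<exists>t\<in>einterval \<alpha> \<beta>. \<forall>s\<in>einterval \<alpha> \<beta>. s < t \<longrightarrow> P (ereal s)" by blast
next
  assume "\<exists>t\<in>einterval \<alpha> \<beta>. \<forall>s\<in>einterval \<alpha> \<beta>. s < t \<longrightarrow> P (ereal s)"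
  then obtain t where t: "\<alpha> < ereal t" "ereal t < \<beta>"
      "\<And>s. s \<in> einterval \<alpha> \<beta> \<Longrightarrow> s < t \<Longrightarrow> P (ereal s)"
    by (auto simp: einterval_iff)
  have "P y" if y: "\<alpha> < y" "y < ereal t" for y
  proof (cases y)
    case (real s)
    then show ?thesis using t y less_trans[OF y(2) t(2)] by (auto simp: einterval_iff)
  qed (use y in auto)
  then show "eventually P (at_right \<alpha>)"
    using eventually_at_right[OF \<open>\<alpha> < \<beta>\<close>] t(1) by blast
qed

lemma Icc_subset_einterval:
  assumes "a \<in> einterval \<alpha> \<beta>" "b \<in> einterval \<alpha> \<beta>"
  shows "{a..b} \<subseteq> einterval \<alpha> \<beta>"
proof
  fix x assume "x \<in> {a..b}"
  then have "ereal a \<le> ereal x" "ereal x \<le> ereal b" by simp_all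
  then show "x \<in> einterval \<alpha> \<beta>"
    using assms less_le_trans[of \<alpha> "ereal a" "ereal x"] le_less_trans[of "ereal x" "ereal b" \<beta>]
    by (simp add: einterval_iff)
qed

text \<open>Boundedness of times is what an integral of \<open>dt/du\<close> can detect. Looking
  only at times after \<open>t0\<close> matches an integral over the values below that at
  \<open>t0\<close>.\<close>

lemma einterval_bounded_right_iff:
  assumes "\<alpha> < (\<beta>::ereal)" "t0 \<in> einterval \<alpha> \<beta>"
  shows "\<beta> < \<infinity> \<longleftrightarrow> (\<exists>B. \<forall>t\<in>einterval \<alpha> \<beta>. t0 \<le> t \<longrightarrow> t \<le> B)"
proof
  assume "\<beta> < \<infinity>"
  then show "\<exists>B. \<forall>t\<in>einterval \<alpha> \<beta>. t0 \<le> t \<longrightarrow> t \<le> B"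
    using assms by (intro exI[of _ "real_of_ereal \<beta>"]; cases \<beta>) (auto simp: einterval_iff)
next
  assume "\<exists>B. \<forall>t\<in>einterval \<alpha> \<beta>. t0 \<le> t \<longrightarrow> t \<le> B"
  then obtain B where B: "\<And>t. t \<in> einterval \<alpha> \<beta> \<Longrightarrow> t0 \<le> t \<Longrightarrow> t \<le> B" by auto
  show "\<beta> < \<infinity>"
  proof (rule ccontr)
    assume "\<not> \<beta> < \<infinity>"
    define m where "m = max t0 (B + 1)"
    have "\<alpha> < ereal t0" using assms(2) by (simp add: einterval_iff)
    also have "\<dots> \<le> ereal m" by (simp add: m_def del: ereal_max)
    finally have "m \<in> einterval \<alpha> \<beta>" using \<open>\<not> \<beta> < \<infinity>\<close> by (simp add: einterval_iff)
    from B[OF this] show False by (simp add: m_def)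
  qed
qed

section \<open>Elapsed time as an integral over the wave values\<close>

text \<open>On \<open>{a..1/2}\<close> the fundamental theorem gives \<open>T a - T (1/2)\<close>,
  and monotone convergence lets \<open>a\<close> tend to \<open>0\<close>. In the application
  \<open>T x\<close> is the time at which the wave takes the value \<open>x\<close>.\<close>

lemma nn_integral_Ioc_half_finite_iff:
  fixes \<phi> T :: "real \<Rightarrow> real"
  assumes cont: "continuous_on {0<..<1} \<phi>" and pos: "\<And>x. x \<in> {0<..<1} \<Longrightarrow> 0 \<le> \<phi> x"
    and T: "\<And>x. x \<in> {0<..<1} \<Longrightarrow> (T has_real_derivative - \<phi> x) (at x)"
  shows "(\<integral>\<^sup>+x\<in>{0<..1/2}. ennreal (\<phi> x) \<partial>lborel) < \<infinity> \<longleftrightarrow> (\<exists>B. \<forall>x\<in>{0<..1/2}. T x \<le> B)"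
proof -
  \<comment> \<open>The indicator yields a function measurable on the whole line, although
    \<open>\<phi>\<close> is controlled only inside the unit interval.\<close>
  define \<psi> where "\<psi> x = indicator {0<..<1} x * \<phi> x" for x :: real
  have meas: "\<psi> \<in> borel_measurable borel"
    using borel_measurable_continuous_on_indicator[of "{0<..<1}" \<phi>] cont by (simp add: \<psi>_def[abs_def])
  have FTC: "(\<integral>\<^sup>+x. ennreal (\<psi> x) * indicator {a..1/2} x \<partial>lborel) = ennreal (T a - T (1/2))"
    if "a \<in> {0<..1/2}" for a
  proof -
    have "(\<integral>\<^sup>+x. ennreal (\<psi> x) * indicator {a..1/2} x \<partial>lborel) = ennreal (- T (1/2) - - T a)"
    proof (rule nn_integral_FTC_Icc[where f = \<psi> and F = "\<lambda>x. - T x", OF meas])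
      fix x :: real assume "x \<in> {a..1/2}"
      then have x: "x \<in> {0<..<1}" using that by auto
      show "((\<lambda>x. - T x) has_real_derivative \<psi> x) (at x)"
        using DERIV_minus[OF T[OF x]] x by (simp add: \<psi>_def)
      show "0 \<le> \<psi> x" using pos[OF x] x by (simp add: \<psi>_def)
    qed (use that in auto)
    then show ?thesis by simp
  qed
  have eq: "(\<integral>\<^sup>+x\<in>{0<..1/2}. ennreal (\<phi> x) \<partial>lborel) = (\<integral>\<^sup>+x\<in>{0<..1/2}. ennreal (\<psi> x) \<partial>lborel)"
    by (rule nn_integral_cong) (auto simp: \<psi>_def indicator_def)
  show ?thesis
  proof
    assume fin: "(\<integral>\<^sup>+x\<in>{0<..1/2}. ennreal (\<phi> x) \<partial>lborel) < \<infinity>"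
    define I where "I = enn2real (\<integral>\<^sup>+x\<in>{0<..1/2}. ennreal (\<phi> x) \<partial>lborel)"
    have "T a \<le> I + T (1/2)" if a: "a \<in> {0<..1/2}" for a
    proof -
      have "ennreal (T a - T (1/2)) \<le> (\<integral>\<^sup>+x\<in>{0<..1/2}. ennreal (\<psi> x) \<partial>lborel)"
        unfolding FTC[OF a, symmetric]
        by (rule nn_integral_mono) (use a in \<open>auto simp: indicator_def\<close>)
      also have "\<dots> = ennreal I" using fin by (simp add: I_def eq[symmetric])
      finally have "T a - T (1/2) \<le> I" by (subst (asm) ennreal_le_iff) (auto simp: I_def)
      then show ?thesis by simp
    qed
    then show "\<exists>B. \<forall>x\<in>{0<..1/2}. T x \<le> B" by blast
  next
    assume "\<exists>B. \<forall>x\<in>{0<..1/2}. T x \<le> B"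
    then obtain B where B: "\<And>x. x \<in> {0<..1/2} \<Longrightarrow> T x \<le> B" by blast
    \<comment> \<open>The summand \<open>2\<close> keeps the left end at most \<open>1/2\<close>,
      also for \<open>n = 0\<close>, as \<open>FTC\<close> demands.\<close>
    define A where "A n = {1 / (real n + 2)..1/2 :: real}" for n
    have "(\<integral>\<^sup>+x\<in>{0<..1/2}. ennreal (\<psi> x) \<partial>lborel) =
        (\<integral>\<^sup>+x. (SUP n. ennreal (\<psi> x) * indicator (A n) x) \<partial>lborel)"
    proof (rule nn_integral_cong)
      fix x :: real


      show "ennreal (\<psi> x) * indicator {0<..1/2} x = (SUP n. ennreal (\<psi> x) * indicator (A n) x)"
      proof (rule antisym)
        show "ennreal (\<psi> x) * indicator {0<..1/2} x \<le> (SUP n. ennreal (\<psi> x) * indicator (A n) x)"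
        proof (cases "x \<in> {0<..1/2}")
          case True
          obtain n where "1 / x < real n" using reals_Archimedean2 by blast
          then have "x \<in> A n" using True by (auto simp: A_def field_simps)
          then show ?thesis using True by (intro SUP_upper2[of n]) auto
        qed simp
        have "A n \<subseteq> {0<..1/2}" for n
        proof
          fix z assume "z \<in> A n"
          then have z: "1 / (real n + 2) \<le> z" "z \<le> 1/2" by (simp_all add: A_def)
          have "0 < 1 / (real n + 2)" by simp
          also note z(1)
          finally show "z \<in> {0<..1/2}" using z(2) by simp
        qed
        then show "(SUP n. ennreal (\<psi> x) * indicator (A n) x) \<le> ennreal (\<psi> x) * indicator {0<..1/2} x"
          by (intro SUP_least mult_left_mono) (auto simp: indicator_def subset_iff)
      qed
    qed
    also have "\<dots> = (SUP n. \<integral>\<^sup>+x. ennreal (\<psi> x) * indicator (A n) x \<partial>lborel)"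
    proof (rule nn_integral_monotone_convergence_SUP)
      show "incseq (\<lambda>n x. ennreal (\<psi> x) * indicator (A n) x)"
      proof (intro incseq_SucI le_funI mult_left_mono)
        fix n x
        have "1 / (real (Suc n) + 2) \<le> 1 / (real n + 2)" by (intro frac_le) auto
        then show "(indicator (A n) x :: ennreal) \<le> indicator (A (Suc n)) x"
          by (auto simp: A_def indicator_def)
      qed auto
    qed (use meas in \<open>auto simp: A_def\<close>)
    also have "\<dots> \<le> ennreal (B - T (1/2))"
    proof (rule SUP_least)
      fix n :: nat
      have n: "1 / (real n + 2) \<in> {0<..1/2}" by (auto simp: field_simps)
      show "(\<integral>\<^sup>+x. ennreal (\<psi> x) * indicator (A n) x \<partial>lborel) \<le> ennreal (B - T (1/2))"
        unfolding A_def FTC[OF n] using B[OF n] by (intro ennreal_leI) simp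
    qed
    also have "\<dots> < \<infinity>" by simp
    finally show "(\<integral>\<^sup>+x\<in>{0<..1/2}. ennreal (\<phi> x) \<partial>lborel) < \<infinity>" by (simp add: eq)
  qed
qed

text \<open>The endpoints are the infimum and supremum of \<open>T\<close>, possibly infinite. By
  strict monotonicity and the intermediate value theorem \<open>T\<close> maps the unit interval
  onto the open interval between them, and \<open>u\<close> is its inverse. The limits are recorded
  as \<open>at_left 1\<close> and \<open>at_right 0\<close> because they get composed with one-sided
  limits of a profile.\<close>

lemma decreasing_inverse_on_unit_interval:
  fixes \<phi> T :: "real \<Rightarrow> real"
  assumes pos: "\<And>x. x \<in> {0<..<1} \<Longrightarrow> 0 < \<phi> x"
    and T: "\<And>x. x \<in> {0<..<1} \<Longrightarrow> (T has_real_derivative - \<phi> x) (at x)"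
  obtains \<alpha> \<beta> :: ereal and u where "\<alpha> < \<beta>" "u ` einterval \<alpha> \<beta> \<subseteq> {0<..<1}"
    "\<And>t. t \<in> einterval \<alpha> \<beta> \<Longrightarrow> (u has_real_derivative - 1 / \<phi> (u t)) (at t)"
    "filterlim (u \<circ> real_of_ereal) (at_left 1) (at_right \<alpha>)"
    "filterlim (u \<circ> real_of_ereal) (at_right 0) (at_left \<beta>)"
proof -
  define \<alpha> where "\<alpha> = (INF x\<in>{0<..<1}. ereal (T x))"
  define \<beta> where "\<beta> = (SUP x\<in>{0<..<1}. ereal (T x))"
  define u where "u = the_inv_into {0<..<1} T"
  have dec: "T y < T x" if "x < y" "x \<in> {0<..<1}" "y \<in> {0<..<1}" for x y
  proof (rule DERIV_neg_imp_decreasing[OF \<open>x < y\<close>])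
    fix z assume "x \<le> z" "z \<le> y"
    then have z: "z \<in> {0<..<1}" using that by auto
    show "\<exists>m. (T has_real_derivative m) (at z) \<and> m < 0" using T[OF z] pos[OF z] by auto
  qed
  have inj: "inj_on T {0<..<1}"
    by (rule linorder_inj_onI) (use dec in force)+
  have contT: "continuous_on {0<..<1} T"
    using T by (intro continuous_at_imp_continuous_on ballI DERIV_isCont)
  \<comment> \<open>Comparison with the points halfway to \<open>0\<close> and halfway to
    \<open>1\<close> shows that neither extremum is attained.\<close>
  have mem: "T x \<in> einterval \<alpha> \<beta>" if x: "x \<in> {0<..<1}" for x
  proof -
    have h: "x/2 \<in> {0<..<1}" "(x+1)/2 \<in> {0<..<1}" using x by auto
    have "\<alpha> \<le> ereal (T ((x+1)/2))" unfolding \<alpha>_def by (rule INF_lower[OF h(2)])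
    also have "\<dots> < ereal (T x)" using dec[of x "(x+1)/2"] x h by simp
    finally have 1: "\<alpha> < ereal (T x)" .
    have "ereal (T x) < ereal (T (x/2))" using dec[of "x/2" x] x h by simp
    also have "\<dots> \<le> \<beta>" unfolding \<beta>_def by (rule SUP_upper[OF h(1)])
    finally show ?thesis using 1 by (simp add: einterval_iff)
  qed
  have range: "t \<in> T ` {0<..<1}" if t: "t \<in> einterval \<alpha> \<beta>" for t
  proof -
    from t obtain x where x: "x \<in> {0<..<1}" "T x < t"
      unfolding einterval_iff \<alpha>_def INF_less_iff by auto
    from t obtain y where y: "y \<in> {0<..<1}" "t < T y"
      unfolding einterval_iff \<beta>_def less_SUP_iff by auto
    have "y < x" using dec[of x y] x y by (cases x y rule: linorder_cases) auto
    then have "\<exists>z\<ge>y. z \<le> x \<and> T z = t"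
      by (intro IVT2' continuous_on_subset[OF contT]) (use x y in auto)
    then show ?thesis using x y by force
  qed
  have uT: "u (T x) = x" if "x \<in> {0<..<1}" for x
    unfolding u_def by (rule the_inv_into_f_f[OF inj that])
  have Tu: "T (u t) = t" if "t \<in> einterval \<alpha> \<beta>" for t
    unfolding u_def by (rule f_the_inv_into_f[OF inj range[OF that]])
  have u_mem: "u t \<in> {0<..<1}" if "t \<in> einterval \<alpha> \<beta>" for t
    unfolding u_def by (rule the_inv_into_into[OF inj range[OF that] order_refl])
  have "\<alpha> < \<beta>" using mem[of "1/2"] by (auto simp: einterval_iff)
  have lt_iff: "u s < x \<longleftrightarrow> T x < s" "x < u s \<longleftrightarrow> s < T x" if "s \<in> einterval \<alpha> \<beta>" "x \<in> {0<..<1}" for s x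
    using dec[of x "u s"] dec[of "u s" x] u_mem[OF that(1)] Tu[OF that(1)] that(2)
    by (cases x "u s" rule: linorder_cases; force)+
  show thesis
  proof
    show "u ` einterval \<alpha> \<beta> \<subseteq> {0<..<1}" using u_mem by auto
    show "(u has_real_derivative - 1 / \<phi> (u t)) (at t)" if t: "t \<in> einterval \<alpha> \<beta>" for t
    proof -
      have "(u has_derivative (*) (- 1 / \<phi> (u t))) (at (T (u t)))"
      proof (rule has_derivative_inverse_strong[of "{0<..<1}" "u t" T u "(*) (- \<phi> (u t))"])
        show "(T has_derivative (*) (- \<phi> (u t))) (at (u t))"
          using T[OF u_mem[OF t]] by (simp add: has_field_derivative_def)
        show "(*) (- \<phi> (u t)) \<circ> (*) (- 1 / \<phi> (u t)) = id"
          using pos[OF u_mem[OF t]] by auto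
      qed (use u_mem[OF t] uT contT in auto)
      then show ?thesis using Tu[OF t] by (simp add: has_field_derivative_def)
    qed
    show "filterlim (u \<circ> real_of_ereal) (at_left 1) (at_right \<alpha>)"
      unfolding filterlim_at
    proof
      show "\<forall>\<^sub>F x in at_right \<alpha>. (u \<circ> real_of_ereal) x \<in> {..<1} \<and> (u \<circ> real_of_ereal) x \<noteq> 1"
        unfolding eventually_at_right_einterval[OF \<open>\<alpha> < \<beta>\<close>]
        by (rule bexI[OF _ mem[of "1/2"]]) (use u_mem in force)+
      show "((u \<circ> real_of_ereal) \<longlongrightarrow> 1) (at_right \<alpha>)"
      proof (rule order_tendstoI)
        fix e :: real assume "e < 1"
        then have e: "max (1/2) e \<in> {0<..<1}" by auto
        show "\<forall>\<^sub>F x in at_right \<alpha>. e < (u \<circ> real_of_ereal) x"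
          unfolding eventually_at_right_einterval[OF \<open>\<alpha> < \<beta>\<close>]
          by (rule bexI[OF _ mem[OF e]]) (use lt_iff(2)[OF _ e] in auto)
      next
        fix e :: real assume "1 < e"
        then show "\<forall>\<^sub>F x in at_right \<alpha>. (u \<circ> real_of_ereal) x < e"
          unfolding eventually_at_right_einterval[OF \<open>\<alpha> < \<beta>\<close>]
          by (intro bexI[OF _ mem[of "1/2"]]) (use u_mem in force)+
      qed
    qed
    show "filterlim (u \<circ> real_of_ereal) (at_right 0) (at_left \<beta>)"
      unfolding filterlim_at
    proof
      show "\<forall>\<^sub>F x in at_left \<beta>. (u \<circ> real_of_ereal) x \<in> {0<..} \<and> (u \<circ> real_of_ereal) x \<noteq> 0"
        unfolding eventually_at_left_einterval[OF \<open>\<alpha> < \<beta>\<close>]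
        by (rule bexI[OF _ mem[of "1/2"]]) (use u_mem in force)+
      show "((u \<circ> real_of_ereal) \<longlongrightarrow> 0) (at_left \<beta>)"
      proof (rule order_tendstoI)
        fix e :: real assume "0 < e"
        then have e: "min (1/2) e \<in> {0<..<1}" by auto
        show "\<forall>\<^sub>F x in at_left \<beta>. (u \<circ> real_of_ereal) x < e"
          unfolding eventually_at_left_einterval[OF \<open>\<alpha> < \<beta>\<close>]
          by (rule bexI[OF _ mem[OF e]]) (use lt_iff(1)[OF _ e] in auto)
      next
        fix e :: real assume "e < 0"
        then show "\<forall>\<^sub>F x in at_left \<beta>. e < (u \<circ> real_of_ereal) x"
          unfolding eventually_at_left_einterval[OF \<open>\<alpha> < \<beta>\<close>]
          by (intro bexI[OF _ mem[of "1/2"]]) (use u_mem in force)+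
      qed
    qed
  qed fact
qed

section \<open>From profiles to waves\<close>

text \<open>For a decreasing wave, \<open>y = d * \<bar>u'\<bar> powr (p - 1)\<close> means
  \<open>u' = - (y / d) powr r\<close>. This first-order equation is solved by integrating
  \<open>dt/du = - (d / y) powr r\<close> and inverting.\<close>

lemma profile_imp_travelling_wave:
  fixes p c :: real and f g \<rho> d y :: "real \<Rightarrow> real"
  defines "r \<equiv> 1 / (p - 1)"
  assumes "p > 1" and f: "continuous_on {0<..<1} f" and g: "continuous_on {0<..<1} g"
    and \<rho>: "continuous_on {0<..<1} \<rho>" and d: "continuous_on {0<..<1} d"
    and dpos: "\<And>x. x \<in> {0<..<1} \<Longrightarrow> d x > 0"
    and y: "unit_profile r (\<lambda>x. c * g x - f x) (\<lambda>x. \<rho> x * d x powr r) y"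
    and y0: "(y \<longlongrightarrow> 0) (at_right 0)" and y1: "(y \<longlongrightarrow> 0) (at_left 1)"
  shows "\<exists>\<alpha> \<beta> u. travelling_wave p f g \<rho> d c \<alpha> \<beta> u"
proof -
  have ypos: "y x > 0" if "x \<in> {0<..<1}" for x using y that by (simp add: unit_profile_def)
  define \<phi> where "\<phi> x = (d x / y x) powr r" for x
  have \<phi>pos: "\<phi> x > 0" if "x \<in> {0<..<1}" for x
    using dpos[OF that] ypos[OF that] by (simp add: \<phi>_def)
  have ne: "d x / y x \<noteq> 0" if "x \<in> {0<..<1}" for x using dpos[OF that] ypos[OF that] by simp
  have cont: "continuous_on {0<..<1} \<phi>"
    unfolding \<phi>_def using ypos ne
    by (intro continuous_intros d unit_profile_continuous_on[OF y]) force+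
  have "isCont (\<lambda>x. - \<phi> x) x" if "x \<in> {0<..<1}" for x
    using continuous_on_minus[OF cont] that by (simp add: continuous_on_eq_continuous_at)
  \<comment> \<open>Any antiderivative will do: adding a constant to \<open>T\<close> only
    translates the wave in time.\<close>
  then obtain T where T: "\<And>x. x \<in> {0<..<1} \<Longrightarrow> (T has_real_derivative - \<phi> x) (at x)"
    using einterval_antiderivative[of 0 1 "\<lambda>x. - \<phi> x"]
    by (auto simp: has_real_derivative_iff_has_vector_derivative)
  obtain \<alpha> \<beta> :: ereal and u where "\<alpha> < \<beta>" and u: "u ` einterval \<alpha> \<beta> \<subseteq> {0<..<1}"
    and du: "\<And>t. t \<in> einterval \<alpha> \<beta> \<Longrightarrow> (u has_real_derivative - 1 / \<phi> (u t)) (at t)"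
    and lim1: "filterlim (u \<circ> real_of_ereal) (at_left 1) (at_right \<alpha>)"
    and lim0: "filterlim (u \<circ> real_of_ereal) (at_right 0) (at_left \<beta>)"
    using decreasing_inverse_on_unit_interval[OF \<phi>pos T] by blast
  let ?I = "einterval \<alpha> \<beta>"
  have u_mem: "u t \<in> {0<..<1}" if "t \<in> ?I" for t using u that by auto
  have contu: "continuous_on ?I u"
    by (intro continuous_at_imp_continuous_on ballI DERIV_isCont[OF du])
  have comp: "continuous_on ?I (\<lambda>t. k (u t))" if "continuous_on {0<..<1} k" for k :: "real \<Rightarrow> real"
    by (rule continuous_on_compose2[OF that contu u])
  have \<phi>_ne: "\<phi> (u t) \<noteq> 0" if "t \<in> ?I" for t using \<phi>pos[OF u_mem[OF that]] by simp
  have deriv_u: "deriv u t = - 1 / \<phi> (u t)" if "t \<in> ?I" for t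
    by (rule DERIV_imp_deriv[OF du[OF that]])
  have flux: "flux p d u t = - y (u t)" if t: "t \<in> ?I" for t
  proof -
    define q where "q = 1 / \<phi> (u t)"
    have "q > 0" using \<phi>pos[OF u_mem[OF t]] by (simp add: q_def)
    have "r * (p - 1) = 1" using \<open>p > 1\<close> by (simp add: r_def)
    then have "\<phi> (u t) powr (p - 1) = d (u t) / y (u t)"
      using dpos[OF u_mem[OF t]] ypos[OF u_mem[OF t]] by (simp add: \<phi>_def powr_powr)
    then have *: "q powr (p - 1) = y (u t) / d (u t)"
      using \<phi>pos[OF u_mem[OF t]] by (simp add: q_def powr_divide)
    \<comment> \<open>Splitting the exponent matches the shape of \<open>flux\<close>; it is valid
      for negative \<open>p - 2\<close> too, as the base \<open>q\<close> is positive.\<close>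
    have "p - 1 = (p - 2) + 1" by simp
    then have "q powr (p - 1) = q powr (p - 2) * q"
      using \<open>q > 0\<close> by (simp only: powr_add powr_one)
    then have "q powr (p - 2) * q = y (u t) / d (u t)" using * by simp
    then have "d (u t) * (q powr (p - 2) * q) = y (u t)" using dpos[OF u_mem[OF t]] by simp
    moreover have "deriv u t = - q" using deriv_u[OF t] by (simp add: q_def)
    ultimately show ?thesis using \<open>q > 0\<close> by (simp add: flux_def)
  qed
  \<comment> \<open>The derivative of the flux that the wave equation dictates when
    \<open>u' = - 1 / \<phi> (u t)\<close>.\<close>
  define W where "W t = (c * g (u t) - f (u t)) / \<phi> (u t) - \<rho> (u t)" for t
  have dflux: "(flux p d u has_real_derivative W t) (at t)" if t: "t \<in> ?I" for t
  proof (rule has_field_derivative_transform_within_open[OF _ open_einterval t])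
    let ?x = "u t"
    have x: "?x \<in> {0<..<1}" by (rule u_mem[OF t])
    have "(y has_real_derivative (c * g ?x - f ?x) - \<rho> ?x * d ?x powr r * y ?x powr (- r)) (at ?x)"
      using y x by (simp add: unit_profile_def)
    from DERIV_minus[OF DERIV_chain2[OF this du[OF t]]]
    have "((\<lambda>t. - y (u t)) has_real_derivative
        ((c * g ?x - f ?x) - \<rho> ?x * d ?x powr r * y ?x powr (- r)) * (1 / \<phi> ?x)) (at t)"
      by simp
    also have "\<rho> ?x * d ?x powr r * y ?x powr (- r) = \<rho> ?x * \<phi> ?x"
      using dpos[OF x] ypos[OF x] by (simp add: \<phi>_def powr_divide powr_minus_divide)
    also have "((c * g ?x - f ?x) - \<rho> ?x * \<phi> ?x) * (1 / \<phi> ?x) = W t"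
      using \<phi>pos[OF x] by (simp add: W_def diff_divide_distrib)
    finally show "((\<lambda>t. - y (u t)) has_real_derivative W t) (at t)" .
  qed (simp add: flux)
  show ?thesis
    unfolding travelling_wave_def
  proof (intro exI conjI ballI)
    show "\<alpha> < \<beta>" by fact
    show "u C1_differentiable_on ?I"
      unfolding C1_differentiable_on_def
    proof (intro exI conjI ballI)
      show "(u has_vector_derivative - 1 / \<phi> (u t)) (at t)" if "t \<in> ?I" for t
        using du[OF that] by (simp add: has_real_derivative_iff_has_vector_derivative)
      show "continuous_on ?I (\<lambda>t. - 1 / \<phi> (u t))"
        using \<phi>_ne by (intro continuous_intros comp cont) auto
    qed
    show "flux p d u C1_differentiable_on ?I"
      unfolding C1_differentiable_on_def
    proof (intro exI conjI ballI)
      show "(flux p d u has_vector_derivative W t) (at t)" if "t \<in> ?I" for t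
        using dflux[OF that] by (simp add: has_real_derivative_iff_has_vector_derivative)
      show "continuous_on ?I W"
        unfolding W_def using \<phi>_ne by (intro continuous_intros comp cont f g \<rho>) auto
    qed
    show "0 < u t" "u t < 1" if "t \<in> ?I" for t using u_mem[OF that] by auto
    show "deriv (flux p d u) t + (c * g (u t) - f (u t)) * deriv u t + \<rho> (u t) = 0"
      if "t \<in> ?I" for t
      by (simp add: DERIV_imp_deriv[OF dflux[OF that]] deriv_u[OF that] W_def)
    show "((u \<circ> real_of_ereal) \<longlongrightarrow> 1) (at_right \<alpha>)" using lim1 by (simp add: filterlim_at)
    show "((u \<circ> real_of_ereal) \<longlongrightarrow> 0) (at_left \<beta>)" using lim0 by (simp add: filterlim_at)
    have eqv: "\<forall>\<^sub>F s in at_right \<alpha>. - y ((u \<circ> real_of_ereal) s) = (flux p d u \<circ> real_of_ereal) s"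
        "\<forall>\<^sub>F s in at_left \<beta>. - y ((u \<circ> real_of_ereal) s) = (flux p d u \<circ> real_of_ereal) s"
      unfolding eventually_at_right_einterval[OF \<open>\<alpha> < \<beta>\<close>] eventually_at_left_einterval[OF \<open>\<alpha> < \<beta>\<close>]
      using einterval_nonempty[OF \<open>\<alpha> < \<beta>\<close>] by (auto simp: flux)
    show "((flux p d u \<circ> real_of_ereal) \<longlongrightarrow> 0) (at_right \<alpha>)"
      using Lim_transform_eventually[OF tendsto_minus[OF filterlim_compose[OF y1 lim1]] eqv(1)]
      by (simp only: minus_zero)
    show "((flux p d u \<circ> real_of_ereal) \<longlongrightarrow> 0) (at_left \<beta>)"
      using Lim_transform_eventually[OF tendsto_minus[OF filterlim_compose[OF y0 lim0]] eqv(2)]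
      by (simp only: minus_zero)
  qed
qed

section \<open>From waves to profiles\<close>

text \<open>Right after \<open>a\<close> the function is negative. At its first return to
  \<open>0\<close> its derivative would be negative, so it would be positive just before, which
  contradicts that this is the first return.\<close>

lemma negative_after_down_crossing:
  fixes w w' :: "real \<Rightarrow> real"
  assumes "a < b" and der: "\<And>t. t \<in> {a..b} \<Longrightarrow> (w has_real_derivative w' t) (at t)"
    and zero: "\<And>t. t \<in> {a..b} \<Longrightarrow> w t = 0 \<Longrightarrow> w' t < 0" and "w a \<le> 0"
  shows "w b < 0"
proof (rule ccontr)
  assume "\<not> w b < 0"
  have cont: "continuous_on {a..b} w"
    by (intro continuous_at_imp_continuous_on ballI DERIV_isCont[OF der])
  \<comment> \<open>If \<open>w a = 0\<close>, the negative derivative supplies a nearby later point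
    where \<open>w\<close> is negative; otherwise \<open>a\<close> itself serves.\<close>
  obtain a' where a': "a \<le> a'" "a' < b" "w a' < 0"
  proof (cases "w a = 0")
    case True
    then have "w' a < 0" using zero[of a] \<open>a < b\<close> by simp
    then obtain e where e: "e > 0" "\<And>h. 0 < h \<Longrightarrow> h < e \<Longrightarrow> w (a + h) < w a"
      using DERIV_neg_dec_right[OF der[of a]] \<open>a < b\<close> by auto
    define h where "h = min e (b - a) / 2"
    have "h > 0" "h < e" "a + h < b" using e(1) \<open>a < b\<close> by (auto simp: h_def min_def field_simps)
    then show ?thesis using that[of "a + h"] e(2)[of h] True by simp
  qed (use that[of a] \<open>a < b\<close> \<open>w a \<le> 0\<close> in auto)
  define S where "S = {t \<in> {a'..b}. 0 \<le> w t}"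
  have cont': "continuous_on {a'..b} w" using continuous_on_subset[OF cont] a'(1) by simp
  then have "closed S" unfolding S_def
    by (intro continuous_on_closed_Collect_le) (auto intro: continuous_intros)
  moreover have "bounded S" unfolding S_def by (rule bounded_subset[of "{a'..b}"]) auto
  ultimately have "compact S" by (simp add: compact_eq_bounded_closed)
  moreover have "b \<in> S" using \<open>\<not> w b < 0\<close> a' by (simp add: S_def)
  ultimately obtain s where s: "s \<in> S" "\<And>t. t \<in> S \<Longrightarrow> s \<le> t"
    using compact_attains_inf[of S] by auto
  have "a' \<le> s" "s \<le> b" "0 \<le> w s" using s(1) by (auto simp: S_def)
  then obtain z where z: "a' \<le> z" "z \<le> s" "w z = 0"
    using IVT'[of w a' 0 s] a'(3) continuous_on_subset[OF cont', of "{a'..s}"] by auto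
  then have "s \<le> z" using s \<open>s \<le> b\<close> by (auto simp: S_def)
  then have "w s = 0" using z by simp
  then have "a' < s" using a'(3) \<open>a' \<le> s\<close> by (cases "a' = s") auto
  have "s \<in> {a..b}" using \<open>a' \<le> s\<close> \<open>s \<le> b\<close> a'(1) by simp
  then obtain e where e: "e > 0" "\<And>h. 0 < h \<Longrightarrow> h < e \<Longrightarrow> w s < w (s - h)"
    using DERIV_neg_dec_left[OF der zero] \<open>w s = 0\<close> by metis
  define h where "h = min e (s - a') / 2"
  have h: "h > 0" "h < e" "a' < s - h" using e(1) \<open>a' < s\<close> by (auto simp: h_def min_def field_simps)
  then have "s - h \<in> S" using e(2)[of h] \<open>w s = 0\<close> \<open>s \<le> b\<close> by (simp add: S_def)
  then show False using s(2)[of "s - h"] h(1) by simp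
qed

lemma C1_differentiable_on_imp_DERIV_deriv:
  fixes k :: "real \<Rightarrow> real"
  assumes "k C1_differentiable_on S" "t \<in> S"
  shows "(k has_real_derivative deriv k t) (at t)"
proof -
  obtain m where "(k has_real_derivative m) (at t)"
    using assms by (auto simp: C1_differentiable_on_def has_real_derivative_iff_has_vector_derivative)
  then show ?thesis by (simp add: DERIV_imp_deriv)
qed

text \<open>At a zero of the flux the equation leaves \<open>- \<rho> < 0\<close> for its
  derivative, so the flux crosses \<open>0\<close> only downwards. If \<open>u'\<close> were
  nonnegative at \<open>t\<close>, the flux would be positive at all earlier times and
  \<open>u\<close> would increase up to \<open>u t < 1\<close>, against its limit \<open>1\<close>
  at \<open>\<alpha>\<close>.\<close>

lemma travelling_wave_decreasing:
  assumes tw: "travelling_wave p f g \<rho> d c \<alpha> \<beta> u"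
    and dpos: "\<And>x. x \<in> {0<..<1} \<Longrightarrow> d x > 0" and \<rho>pos: "\<And>x. x \<in> {0<..<1} \<Longrightarrow> \<rho> x > 0"
    and t: "t \<in> einterval \<alpha> \<beta>"
  shows "deriv u t < 0"
proof (rule ccontr)
  let ?I = "einterval \<alpha> \<beta>"
  have "\<alpha> < \<beta>" and C1: "u C1_differentiable_on ?I" "flux p d u C1_differentiable_on ?I"
    and u_mem: "\<And>t. t \<in> ?I \<Longrightarrow> u t \<in> {0<..<1}"
    and eq: "\<And>t. t \<in> ?I \<Longrightarrow>
      deriv (flux p d u) t + (c * g (u t) - f (u t)) * deriv u t + \<rho> (u t) = 0"
    and lim1: "((u \<circ> real_of_ereal) \<longlongrightarrow> 1) (at_right \<alpha>)"
    using tw by (simp_all add: travelling_wave_def)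
  \<comment> \<open>At \<open>u' = 0\<close> the flux vanishes through its last factor; elsewhere
    the other two factors are positive.\<close>
  have sgn: "flux p d u s > 0 \<longleftrightarrow> deriv u s > 0" "flux p d u s = 0 \<longleftrightarrow> deriv u s = 0" if "s \<in> ?I" for s
  proof -
    define k where "k = d (u s) * \<bar>deriv u s\<bar> powr (p - 2)"
    have k: "k > 0" if "deriv u s \<noteq> 0"
      using dpos[OF u_mem[OF \<open>s \<in> ?I\<close>]] that by (simp add: k_def)
    have "flux p d u s = k * deriv u s" by (simp add: flux_def k_def)
    then show "flux p d u s > 0 \<longleftrightarrow> deriv u s > 0" "flux p d u s = 0 \<longleftrightarrow> deriv u s = 0"
      using k by (cases "deriv u s = 0"; simp add: zero_less_mult_iff)+
  qed
  note sub = Icc_subset_einterval[of _ \<alpha> \<beta>]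
  assume "\<not> deriv u t < 0"
  then have "\<not> flux p d u t < 0" using sgn[OF t] by linarith
  have pos: "flux p d u s > 0" if s: "s \<in> ?I" "s < t" for s
  proof (rule ccontr)
    assume "\<not> flux p d u s > 0"
    have "flux p d u t < 0"
    proof (rule negative_after_down_crossing[OF \<open>s < t\<close>, where w' = "deriv (flux p d u)"])
      fix x assume "x \<in> {s..t}"
      then have x: "x \<in> ?I" using sub[OF s(1) t] by blast
      show "(flux p d u has_real_derivative deriv (flux p d u) x) (at x)"
        by (rule C1_differentiable_on_imp_DERIV_deriv[OF C1(2) x])
      show "deriv (flux p d u) x < 0" if "flux p d u x = 0"
        using eq[OF x] sgn(2)[OF x] that \<rho>pos[OF u_mem[OF x]] by simp
    qed (use \<open>\<not> flux p d u s > 0\<close> in simp)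
    with \<open>\<not> flux p d u t < 0\<close> show False by simp
  qed
  have "u s < u t" if s: "s \<in> ?I" "s < t" for s
  proof (rule DERIV_pos_imp_increasing_open[OF \<open>s < t\<close>])
    have der: "(u has_real_derivative deriv u x) (at x)" if "x \<in> {s..t}" for x
      using C1_differentiable_on_imp_DERIV_deriv[OF C1(1)] sub[OF s(1) t] that by blast
    then show "continuous_on {s..t} u" by (intro continuous_at_imp_continuous_on ballI DERIV_isCont)
    show "\<exists>m. (u has_real_derivative m) (at x) \<and> m > 0" if "s < x" "x < t" for x
    proof -
      have "x \<in> ?I" using sub[OF s(1) t] that by (auto simp: subset_iff)
      then have "deriv u x > 0" using pos[of x] sgn(1)[of x] that by simp
      then show ?thesis using der[of x] that by auto
    qed
  qed
  moreover have "\<forall>\<^sub>F s in at_right \<alpha>. u t < (u \<circ> real_of_ereal) s"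
    using order_tendstoD(1)[OF lim1] u_mem[OF t] by simp
  then obtain t' where t': "t' \<in> ?I" "\<And>s. s \<in> ?I \<Longrightarrow> s < t' \<Longrightarrow> u t < u s"
    unfolding eventually_at_right_einterval[OF \<open>\<alpha> < \<beta>\<close>] by auto
  moreover define m where "m = min t t'"
  have "m \<in> ?I" using t t'(1) by (cases "t \<le> t'") (simp_all add: m_def)
  then obtain s where s: "s \<in> einterval \<alpha> (ereal m)"
    using einterval_nonempty[of \<alpha> "ereal m"] by (auto simp: einterval_iff)
  then have "s \<in> ?I"
    using \<open>m \<in> ?I\<close> less_trans[of "ereal s" "ereal m" \<beta>] by (simp add: einterval_iff)
  moreover have "s < t" "s < t'" using s by (simp_all add: einterval_iff m_def del: ereal_min)
  ultimately show False by (meson less_asym)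
qed

text \<open>Let \<open>T\<close> be the inverse of the decreasing function \<open>u\<close>, and
  take minus the flux at time \<open>T x\<close> as \<open>y x\<close>. Dividing the wave equation
  by \<open>u'\<close> gives \<open>y' = h + \<rho> / u'\<close>. Here
  \<open>1 / u' = - (d / y) powr r\<close> is also \<open>dt/du\<close>, so its integral over small
  values decides whether \<open>\<beta>\<close> is finite.\<close>

lemma travelling_wave_imp_profile:
  fixes p c :: real and f g \<rho> d u :: "real \<Rightarrow> real" and \<alpha> \<beta> :: ereal
  defines "r \<equiv> 1 / (p - 1)"
  assumes "p > 1" and contd: "continuous_on {0<..<1} d"
    and dpos: "\<And>x. x \<in> {0<..<1} \<Longrightarrow> d x > 0" and \<rho>pos: "\<And>x. x \<in> {0<..<1} \<Longrightarrow> \<rho> x > 0"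
    and tw: "travelling_wave p f g \<rho> d c \<alpha> \<beta> u"
  obtains y where "unit_profile r (\<lambda>x. c * g x - f x) (\<lambda>x. \<rho> x * d x powr r) y"
    "(y \<longlongrightarrow> 0) (at_right 0)" "(y \<longlongrightarrow> 0) (at_left 1)"
    "\<beta> < \<infinity> \<longleftrightarrow> (\<integral>\<^sup>+x\<in>{0<..1/2}. ennreal ((d x / y x) powr r) \<partial>lborel) < \<infinity>"
proof -
  let ?I = "einterval \<alpha> \<beta>"
  let ?w = "flux p d u"
  have "\<alpha> < \<beta>" and C1: "u C1_differentiable_on ?I" "?w C1_differentiable_on ?I"
    and u_mem: "\<And>t. t \<in> ?I \<Longrightarrow> u t \<in> {0<..<1}"
    and eq: "\<And>t. t \<in> ?I \<Longrightarrow> deriv ?w t + (c * g (u t) - f (u t)) * deriv u t + \<rho> (u t) = 0"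
    and lim1: "((u \<circ> real_of_ereal) \<longlongrightarrow> 1) (at_right \<alpha>)"
    and lim0: "((u \<circ> real_of_ereal) \<longlongrightarrow> 0) (at_left \<beta>)"
    and wlim1: "((?w \<circ> real_of_ereal) \<longlongrightarrow> 0) (at_right \<alpha>)"
    and wlim0: "((?w \<circ> real_of_ereal) \<longlongrightarrow> 0) (at_left \<beta>)"
    using tw by (simp_all add: travelling_wave_def)
  note du = C1_differentiable_on_imp_DERIV_deriv[OF C1(1)]
  note dw = C1_differentiable_on_imp_DERIV_deriv[OF C1(2)]
  have neg: "deriv u t < 0" if "t \<in> ?I" for t
    by (rule travelling_wave_decreasing[OF tw dpos \<rho>pos that])
  note sub = Icc_subset_einterval[of _ \<alpha> \<beta>]
  have contu: "continuous_on ?I u"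
    by (intro continuous_at_imp_continuous_on ballI DERIV_isCont[OF du])
  have dec: "u b < u a" if "a < b" "a \<in> ?I" "b \<in> ?I" for a b
  proof (rule DERIV_neg_imp_decreasing[OF \<open>a < b\<close>])
    fix t assume "a \<le> t" "t \<le> b"
    then have t: "t \<in> ?I" using sub[OF that(2,3)] by auto
    show "\<exists>m. (u has_real_derivative m) (at t) \<and> m < 0" using du[OF t] neg[OF t] by blast
  qed
  have inj: "inj_on u ?I" by (rule linorder_inj_onI) (use dec in force)+
  have range: "x \<in> u ` ?I" if x: "x \<in> {0<..<1}" for x
  proof -
    obtain a where a: "a \<in> ?I" "\<And>s. s \<in> ?I \<Longrightarrow> s < a \<Longrightarrow> x < u s"
      using order_tendstoD(1)[OF lim1, of x] x
      unfolding eventually_at_right_einterval[OF \<open>\<alpha> < \<beta>\<close>] by auto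
    obtain b where b: "b \<in> ?I" "\<And>s. s \<in> ?I \<Longrightarrow> b < s \<Longrightarrow> u s < x"
      using order_tendstoD(2)[OF lim0, of x] x
      unfolding eventually_at_left_einterval[OF \<open>\<alpha> < \<beta>\<close>] by auto
    obtain a' where a': "a' \<in> einterval \<alpha> (ereal a)"
      using einterval_nonempty[of \<alpha> "ereal a"] a(1) by (auto simp: einterval_iff)
    obtain b' where b': "b' \<in> einterval (ereal b) \<beta>"
      using einterval_nonempty[of "ereal b" \<beta>] b(1) by (auto simp: einterval_iff)
    have I: "a' \<in> ?I" "b' \<in> ?I"
      using a' a(1) b' b(1) less_trans[of "ereal a'" "ereal a" \<beta>] less_trans[of \<alpha> "ereal b" "ereal b'"]
      by (simp_all add: einterval_iff)
    have ux: "x < u a'" "u b' < x" using a(2)[OF I(1)] b(2)[OF I(2)] a' b' by (auto simp: einterval_iff)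
    then have "a' \<le> b'" using dec[OF _ I(2,1)] by fastforce
    then have "\<exists>z\<ge>a'. z \<le> b' \<and> u z = x"
      by (intro IVT2' continuous_on_subset[OF contu sub[OF I]]) (use ux in auto)
    then show ?thesis using sub[OF I] by force
  qed
  define T where "T = the_inv_into ?I u"
  have Tu: "T (u t) = t" if "t \<in> ?I" for t unfolding T_def by (rule the_inv_into_f_f[OF inj that])
  have uT: "u (T x) = x" if "x \<in> {0<..<1}" for x
    unfolding T_def by (rule f_the_inv_into_f[OF inj range[OF that]])
  have T_mem: "T x \<in> ?I" if "x \<in> {0<..<1}" for x
    unfolding T_def by (rule the_inv_into_into[OF inj range[OF that] order_refl])
  have lt_iff: "T x < s \<longleftrightarrow> u s < x" "s < T x \<longleftrightarrow> x < u s" if "s \<in> ?I" "x \<in> {0<..<1}" for s x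
    using dec[of s "T x"] dec[of "T x" s] T_mem[OF that(2)] uT[OF that(2)] that(1)
    by (cases s "T x" rule: linorder_cases; force)+
  have dT: "(T has_real_derivative 1 / deriv u (T x)) (at x)" if x: "x \<in> {0<..<1}" for x
  proof -
    let ?m = "deriv u (T x)"
    have "(T has_derivative (*) (1 / ?m)) (at (u (T x)))"
    proof (rule has_derivative_inverse_strong[of ?I "T x" u T "(*) ?m"])
      show "(u has_derivative (*) ?m) (at (T x))"
        using du[OF T_mem[OF x]] by (simp add: has_field_derivative_def)
      show "(*) ?m \<circ> (*) (1 / ?m) = id" using neg[OF T_mem[OF x]] by auto
    qed (use T_mem[OF x] Tu contu in auto)
    then show ?thesis using uT[OF x] by (simp add: has_field_derivative_def)
  qed
  define y where "y x = - ?w (T x)" for x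
  \<comment> \<open>With \<open>q = - u'\<close> the flux relation reads
    \<open>y = d * q powr (p - 1)\<close>, which is inverted by means of
    \<open>(p - 1) * r = 1\<close>.\<close>
  have ypos: "y x > 0" and q: "deriv u (T x) = - ((y x / d x) powr r)" if x: "x \<in> {0<..<1}" for x
  proof -
    define q where "q = - deriv u (T x)"
    have "q > 0" using neg[OF T_mem[OF x]] by (simp add: q_def)
    have "p - 1 = (p - 2) + 1" by simp
    then have "q powr (p - 1) = q powr (p - 2) * q"
      using \<open>q > 0\<close> by (simp only: powr_add powr_one)
    moreover have "deriv u (T x) = - q" by (simp add: q_def)
    ultimately have y: "y x = d x * q powr (p - 1)"
      using \<open>q > 0\<close> by (simp add: y_def flux_def uT[OF x])
    show "y x > 0" using dpos[OF x] \<open>q > 0\<close> by (simp add: y)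
    have "(p - 1) * r = 1" using \<open>p > 1\<close> by (simp add: r_def)
    then have "(y x / d x) powr r = q" using dpos[OF x] \<open>q > 0\<close> by (simp add: y powr_powr)
    then show "deriv u (T x) = - ((y x / d x) powr r)" by (simp add: q_def)
  qed
  have inv: "1 / deriv u (T x) = - ((d x / y x) powr r)" if x: "x \<in> {0<..<1}" for x
    using dpos[OF x] ypos[OF x] by (simp add: q[OF x] powr_divide)
  have prof: "unit_profile r (\<lambda>x. c * g x - f x) (\<lambda>x. \<rho> x * d x powr r) y"
    unfolding unit_profile_def
  proof (intro ballI conjI)
    fix x :: real assume x: "x \<in> {0<..<1}"
    show "0 < y x" by (rule ypos[OF x])
    let ?t = "T x"
    have "(y has_real_derivative - (deriv ?w ?t * (1 / deriv u ?t))) (at x)"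
      unfolding y_def by (rule DERIV_minus[OF DERIV_chain2[OF dw[OF T_mem[OF x]] dT[OF x]]])
    also have "- (deriv ?w ?t * (1 / deriv u ?t)) =
        ((c * g x - f x) * deriv u ?t + \<rho> x) * (1 / deriv u ?t)"
    proof -
      have "- deriv ?w ?t = (c * g x - f x) * deriv u ?t + \<rho> x"
        using eq[OF T_mem[OF x]] by (simp add: uT[OF x])
      then show ?thesis by (metis minus_mult_left)
    qed
    also have "\<dots> = (c * g x - f x) * (deriv u ?t * (1 / deriv u ?t)) + \<rho> x * (1 / deriv u ?t)"
      by (simp only: distrib_right mult.assoc)
    also have "deriv u ?t * (1 / deriv u ?t) = 1" using neg[OF T_mem[OF x]] by simp
    also have "1 / deriv u ?t = - (d x powr r * y x powr (- r))"
      using dpos[OF x] ypos[OF x] by (simp add: inv[OF x] powr_divide powr_minus_divide)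
    finally show "(y has_real_derivative c * g x - f x - \<rho> x * d x powr r * y x powr (- r)) (at x)"
      by (simp add: mult.assoc)
  qed
  show thesis
  proof
    show "(y \<longlongrightarrow> 0) (at_right 0)"
    proof (rule tendstoI)
      fix e :: real assume "e > 0"
      then obtain t where t: "t \<in> ?I" "\<And>s. s \<in> ?I \<Longrightarrow> t < s \<Longrightarrow> \<bar>?w s\<bar> < e"
        using tendstoD[OF wlim0 \<open>e > 0\<close>] unfolding eventually_at_left_einterval[OF \<open>\<alpha> < \<beta>\<close>] by auto
      have "dist (y x) 0 < e" if "0 < x" "x < u t" for x
      proof -
        have x: "x \<in> {0<..<1}" using that u_mem[OF t(1)] by auto
        then show ?thesis using t(2)[OF T_mem[OF x]] lt_iff(2)[OF t(1) x] that by (simp add: y_def)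
      qed
      then show "\<forall>\<^sub>F x in at_right 0. dist (y x) 0 < e"
        using eventually_at_right[of 0 "1::real"] u_mem[OF t(1)] by auto
    qed
    show "(y \<longlongrightarrow> 0) (at_left 1)"
    proof (rule tendstoI)
      fix e :: real assume "e > 0"
      then obtain t where t: "t \<in> ?I" "\<And>s. s \<in> ?I \<Longrightarrow> s < t \<Longrightarrow> \<bar>?w s\<bar> < e"
        using tendstoD[OF wlim1 \<open>e > 0\<close>] unfolding eventually_at_right_einterval[OF \<open>\<alpha> < \<beta>\<close>] by auto
      have "dist (y x) 0 < e" if "u t < x" "x < 1" for x
      proof -
        have x: "x \<in> {0<..<1}" using that u_mem[OF t(1)] by auto
        then show ?thesis using t(2)[OF T_mem[OF x]] lt_iff(1)[OF t(1) x] that by (simp add: y_def)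
      qed
      then show "\<forall>\<^sub>F x in at_left 1. dist (y x) 0 < e"
        using eventually_at_left[of 0 "1::real"] u_mem[OF t(1)] by auto
    qed
    \<comment> \<open>Times from \<open>T (1/2)\<close> on correspond to values in
      \<open>{0<..1/2}\<close>, because \<open>T\<close> is decreasing.\<close>
    have "(\<exists>B. \<forall>t\<in>?I. T (1/2) \<le> t \<longrightarrow> t \<le> B) \<longleftrightarrow> (\<exists>B. \<forall>x\<in>{0<..1/2}. T x \<le> B)"
    proof -
      have "(\<forall>t\<in>?I. T (1/2) \<le> t \<longrightarrow> t \<le> B) \<longleftrightarrow> (\<forall>x\<in>{0<..1/2}. T x \<le> B)" for B
      proof (intro iffI ballI impI)
        fix x :: real assume B: "\<forall>t\<in>?I. T (1/2) \<le> t \<longrightarrow> t \<le> B" and "x \<in> {0<..1/2}"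
        then have x: "x \<in> {0<..<1}" "x \<le> 1/2" by auto
        have "T (1/2) \<le> T x" using lt_iff(1)[OF T_mem[OF x(1)], of "1/2"] lt_iff(2)[OF T_mem[OF x(1)], of "1/2"] uT[OF x(1)] x(2)
          by (simp add: not_less[symmetric])
        then show "T x \<le> B" using B T_mem[OF x(1)] by blast
      next
        fix t assume B: "\<forall>x\<in>{0<..1/2}. T x \<le> B" and t: "t \<in> ?I" "T (1/2) \<le> t"
        have "u t \<le> 1/2" using lt_iff(2)[OF t(1), of "1/2"] t(2) by simp
        then have "u t \<in> {0<..1/2}" using u_mem[OF t(1)] by simp
        from bspec[OF B this] show "t \<le> B" by (simp only: Tu[OF t(1)])
      qed
      then show ?thesis by simp
    qed
    also have "\<dots> \<longleftrightarrow> (\<integral>\<^sup>+x\<in>{0<..1/2}. ennreal ((d x / y x) powr r) \<partial>lborel) < \<infinity>"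
    proof (rule nn_integral_Ioc_half_finite_iff[symmetric])
      show "(T has_real_derivative - ((d x / y x) powr r)) (at x)" if "x \<in> {0<..<1}" for x
        using dT[OF that] by (simp only: inv[OF that])
      have "d x / y x \<noteq> 0" "y x \<noteq> 0" if "x \<in> {0<..<1}" for x
        using dpos[OF that] ypos[OF that] by simp_all
      then show "continuous_on {0<..<1} (\<lambda>x. (d x / y x) powr r)"
        by (intro continuous_intros contd unit_profile_continuous_on[OF prof]) auto
    qed simp
    finally show "\<beta> < \<infinity> \<longleftrightarrow> (\<integral>\<^sup>+x\<in>{0<..1/2}. ennreal ((d x / y x) powr r) \<partial>lborel) < \<infinity>"
      using einterval_bounded_right_iff[OF \<open>\<alpha> < \<beta>\<close> T_mem[of "1/2"]] by simp
  qed (rule prof)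
qed

section \<open>Behaviour of profiles near \<open>0\<close>\<close>

text \<open>The singular term only lowers the slope, so \<open>H * x - y x\<close> is nondecreasing;
  its limit at \<open>0\<close> is \<open>0\<close>.\<close>

lemma unit_profile_upper_bound:
  assumes y: "unit_profile r h D y" and y0: "(y \<longlongrightarrow> 0) (at_right 0)"
    and D: "\<And>x. x \<in> {0<..<1} \<Longrightarrow> 0 \<le> D x" and h: "\<And>x. x \<in> {0<..<1} \<Longrightarrow> h x \<le> H"
    and x: "x \<in> {0<..<1}"
  shows "y x \<le> H * x"
proof -
  have "H * s - y s \<le> H * x - y x" if "0 < s" "s < x" for s
  proof (rule DERIV_nonneg_imp_nondecreasing[of s x "\<lambda>v. H * v - y v"])
    fix v assume "s \<le> v" "v \<le> x"
    then have v: "v \<in> {0<..<1}" using that x by auto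
    have "((\<lambda>v. H * v - y v) has_real_derivative H - (h v - D v * y v powr (- r))) (at v)"
      using y v by (auto simp: unit_profile_def intro!: derivative_eq_intros)
    moreover have "0 \<le> D v * y v powr (- r)" using D[OF v] by simp
    ultimately show "\<exists>m. ((\<lambda>v. H * v - y v) has_real_derivative m) (at v) \<and> 0 \<le> m"
      using h[OF v] by (intro exI conjI) (assumption, linarith)
  qed (use that in simp)
  then have "\<forall>\<^sub>F s in at_right 0. H * s - y s \<le> H * x - y x"
    using eventually_at_right[of 0 x] x by auto
  moreover have "((\<lambda>s. H * s - y s) \<longlongrightarrow> H * 0 - 0) (at_right 0)"
    by (intro tendsto_intros y0)
  ultimately have "H * 0 - 0 \<le> H * x - y x"
    by (intro tendsto_upperbound) auto
  then show ?thesis by simp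
qed

text \<open>Where \<open>y < \<epsilon> \<xi>\<close> the singular term makes \<open>y' - \<epsilon> \<xi>'\<close> very negative, so this inequality
  propagates to the right; if it held arbitrarily close to \<open>0\<close>, then \<open>y\<close> would decrease from \<open>0\<close>.\<close>

lemma unit_profile_lower_bound:
  fixes \<xi> \<xi>' :: "real \<Rightarrow> real"
  assumes "r > 0" and y: "unit_profile r h D y" and y0: "(y \<longlongrightarrow> 0) (at_right 0)"
    and h: "\<And>x. x \<in> {0<..<1} \<Longrightarrow> h x \<le> H"
    and \<delta>: "0 < \<delta>" "\<delta> \<le> 1" and "m > 0" and "0 \<le> B"
    and \<xi>: "\<And>x. x \<in> {0<..<\<delta>} \<Longrightarrow> (\<xi> has_real_derivative \<xi>' x) (at x)"
    and \<xi>': "\<And>x. x \<in> {0<..<\<delta>} \<Longrightarrow> - B \<le> \<xi>' x" and \<xi>pos: "\<And>x. x \<in> {0<..<\<delta>} \<Longrightarrow> 0 < \<xi> x"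
    and D: "\<And>x. x \<in> {0<..<\<delta>} \<Longrightarrow> m * \<xi> x powr r \<le> D x"
  shows "\<exists>\<epsilon>>0. \<exists>\<delta>'>0. \<forall>x. 0 < x \<longrightarrow> x < \<delta>' \<longrightarrow> \<epsilon> * \<xi> x \<le> y x"
proof -
  \<comment> \<open>The constant is chosen so that \<open>y\<close> has slope at most
    \<open>- B - 1\<close> wherever \<open>y < \<epsilon> * \<xi>\<close>, which is below every
    slope of \<open>\<epsilon> * \<xi>\<close>.\<close>
  obtain \<eta> where \<eta>: "\<eta> > 0" "\<And>s. 0 < s \<Longrightarrow> s \<le> \<eta> \<Longrightarrow> H + B + 1 \<le> m * s powr (- r)"
    using powr_minus_ge_near_zero[OF \<open>r > 0\<close> \<open>m > 0\<close>, of "H + B + 1"] by auto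
  \<comment> \<open>\<open>\<epsilon> \<le> \<eta>\<close> brings \<open>y / \<xi>\<close> below
    \<open>\<eta>\<close>, and \<open>\<epsilon> \<le> 1\<close> ensures
    \<open>\<epsilon> * \<xi>' \<ge> - B\<close>.\<close>
  define \<epsilon> where "\<epsilon> = min \<eta> 1"
  have \<epsilon>: "\<epsilon> > 0" "\<epsilon> \<le> \<eta>" "\<epsilon> \<le> 1" using \<eta>(1) by (auto simp: \<epsilon>_def)
  have ypos: "0 < y x" if "x \<in> {0<..<1}" for x using y that by (simp add: unit_profile_def)
  have dy: "(y has_real_derivative h x - D x * y x powr (- r)) (at x)" if "x \<in> {0<..<1}" for x
    using y that by (simp add: unit_profile_def)
  have unit: "x \<in> {0<..<1}" if "x \<in> {0<..<\<delta>}" for x using that \<delta> by auto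
  \<comment> \<open>The bound on \<open>D\<close> makes the singular term at least
    \<open>m * (y / \<xi>) powr (- r)\<close>, so that it is governed by the quotient
    \<open>y / \<xi>\<close>.\<close>
  have steep: "h x - D x * y x powr (- r) \<le> - B - 1" if x: "x \<in> {0<..<\<delta>}" and "y x < \<epsilon> * \<xi> x" for x
  proof -
    have p: "0 < \<xi> x" "0 < y x" using \<xi>pos[OF x] ypos[OF unit[OF x]] by auto
    have "y x / \<xi> x \<le> \<eta>" using that(2) p \<epsilon> by (simp add: divide_le_eq) (meson less_le_trans mult_right_mono less_imp_le)
    then have "H + B + 1 \<le> m * (y x / \<xi> x) powr (- r)" using p by (intro \<eta>) auto
    also have "\<dots> = m * \<xi> x powr r * y x powr (- r)"
      using p by (simp add: powr_divide powr_minus_divide)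
    also have "\<dots> \<le> D x * y x powr (- r)" by (rule mult_right_mono[OF D[OF x]]) simp
    finally show ?thesis using h[OF unit[OF x]] by linarith
  qed
  show ?thesis
  proof (rule ccontr)
    assume neg: "\<not> ?thesis"
    have below: "\<exists>s. 0 < s \<and> s < x \<and> y s < \<epsilon> * \<xi> s" if "0 < x" for x
    proof (rule ccontr)
      assume "\<not> ?thesis"
      then have "\<forall>s. 0 < s \<longrightarrow> s < x \<longrightarrow> \<epsilon> * \<xi> s \<le> y s" by (meson not_less)
      with neg \<open>0 < x\<close> \<epsilon>(1) show False by blast
    qed
    have all: "y x < \<epsilon> * \<xi> x" if x: "x \<in> {0<..<\<delta>}" for x
    proof -
      obtain s where s: "0 < s" "s < x" "y s < \<epsilon> * \<xi> s" using below x by auto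
      have "\<epsilon> * \<xi> s - y s \<le> \<epsilon> * \<xi> x - y x"
      proof (rule DERIV_nonneg_while_pos_imp_nondecreasing[of s x "\<lambda>v. \<epsilon> * \<xi> v - y v"])
        have der: "((\<lambda>v. \<epsilon> * \<xi> v - y v) has_real_derivative \<epsilon> * \<xi>' v - (h v - D v * y v powr (- r))) (at v)"
          if "v \<in> {0<..<\<delta>}" for v
          by (intro DERIV_diff DERIV_cmult \<xi> dy that unit)
        then show "continuous_on {s..x} (\<lambda>v. \<epsilon> * \<xi> v - y v)"
          using s x by (intro continuous_at_imp_continuous_on ballI DERIV_isCont[OF der]) auto
        fix v assume v: "s < v" "v < x" "0 < \<epsilon> * \<xi> v - y v"
        then have v': "v \<in> {0<..<\<delta>}" using s x by auto
        have "- B \<le> \<epsilon> * (- B)" using \<epsilon> \<open>0 \<le> B\<close> by (simp add: mult_left_le_one_le)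
        also have "\<dots> \<le> \<epsilon> * \<xi>' v" using \<xi>'[OF v'] \<epsilon>(1) by (intro mult_left_mono) auto
        finally have "0 \<le> \<epsilon> * \<xi>' v - (h v - D v * y v powr (- r))"
          using steep[OF v'] v(3) by linarith
        then show "\<exists>m. ((\<lambda>v. \<epsilon> * \<xi> v - y v) has_real_derivative m) (at v) \<and> 0 \<le> m"
          using der[OF v'] by blast
      qed (use s in auto)
      then show ?thesis using s(3) by simp
    qed
    define x where "x = \<delta> / 2"
    have x: "x \<in> {0<..<\<delta>}" using \<delta> by (simp add: x_def)
    have "y x \<le> y s" if "0 < s" "s < x" for s
    proof (rule DERIV_nonpos_imp_nonincreasing[of s x y])
      fix v assume "s \<le> v" "v \<le> x"
      then have v: "v \<in> {0<..<\<delta>}" using that x by auto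
      show "\<exists>m. (y has_real_derivative m) (at v) \<and> m \<le> 0"
        using dy[OF unit[OF v]] steep[OF v all[OF v]] \<open>0 \<le> B\<close>
        by (intro exI[of _ "h v - D v * y v powr (- r)"]) auto
    qed (use that in simp)
    then have "\<forall>\<^sub>F s in at_right 0. y x \<le> y s" using eventually_at_right[of 0 x] x by auto
    then have "y x \<le> 0" by (intro tendsto_lowerbound[OF y0]) auto
    then show False using ypos[OF unit[OF x]] by simp
  qed
qed

section \<open>Comparison of integrals near \<open>0\<close> and minimality of the speed\<close>

text \<open>Only the behaviour at \<open>0\<close> matters: on the remaining compact interval
  \<open>A\<close> is continuous, hence bounded.\<close>

lemma nn_integral_Ioc_half_finite_compare:
  fixes A B :: "real \<Rightarrow> real"
  assumes A: "continuous_on {0<..<1} A" and B: "continuous_on {0<..<1} B"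
    and "0 \<le> C" "\<delta> > 0"
    and le: "\<And>x. 0 < x \<Longrightarrow> x < \<delta> \<Longrightarrow> x < 1 \<Longrightarrow> A x \<le> C * B x"
    and fin: "(\<integral>\<^sup>+x\<in>{0<..1/2}. ennreal (B x) \<partial>lborel) < \<infinity>"
  shows "(\<integral>\<^sup>+x\<in>{0<..1/2}. ennreal (A x) \<partial>lborel) < \<infinity>"
proof -
  define b where "b x = indicator {0<..<1} x * B x" for x :: real
  have meas [measurable]: "b \<in> borel_measurable borel"
    using borel_measurable_continuous_on_indicator[of "{0<..<1}" B] B by (simp add: b_def[abs_def])
  define \<gamma> where "\<gamma> = min \<delta> (1/2)"
  have \<gamma>: "0 < \<gamma>" "\<gamma> \<le> 1/2" "\<gamma> \<le> \<delta>" using \<open>\<delta> > 0\<close> by (auto simp: \<gamma>_def)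
  have "continuous_on {\<gamma>..1/2} A" by (rule continuous_on_subset[OF A]) (use \<gamma> in auto)
  then obtain K where K: "\<And>x. x \<in> {\<gamma>..1/2} \<Longrightarrow> A x \<le> K"
    using continuous_attains_sup[of "{\<gamma>..1/2}" A] \<gamma>(2)
    by (metis atLeastatMost_empty_iff compact_Icc)
  have "(\<integral>\<^sup>+x\<in>{0<..1/2}. ennreal (A x) \<partial>lborel) \<le>
      (\<integral>\<^sup>+x. ennreal C * (ennreal (b x) * indicator {0<..1/2} x) + ennreal K * indicator {\<gamma>..1/2} x \<partial>lborel)"
  proof (rule nn_integral_mono)
    fix x :: real
    consider "x \<notin> {0<..1/2}" | "0 < x" "x < \<gamma>" | "x \<in> {\<gamma>..1/2}" using \<gamma> by force
    then show "ennreal (A x) * indicator {0<..1/2} x \<le>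
        ennreal C * (ennreal (b x) * indicator {0<..1/2} x) + ennreal K * indicator {\<gamma>..1/2} x"
    proof cases
      case 2
      then have "ennreal (A x) \<le> ennreal (C * B x)" using le[of x] \<gamma> by (intro ennreal_leI) auto
      also have "\<dots> = ennreal C * ennreal (b x)"
        using 2 \<gamma> \<open>0 \<le> C\<close> by (simp add: b_def ennreal_mult')
      finally show ?thesis using 2 \<gamma> by simp
    next
      case 3
      then have "ennreal (A x) \<le> ennreal K" using K by (intro ennreal_leI)
      then show ?thesis using 3 \<gamma> by (simp add: add_increasing)
    qed simp
  qed
  also have "\<dots> = ennreal C * (\<integral>\<^sup>+x\<in>{0<..1/2}. ennreal (b x) \<partial>lborel) + ennreal K * emeasure lborel {\<gamma>..1/2}"
    by (subst nn_integral_add) (auto simp: nn_integral_cmult)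
  also have "(\<integral>\<^sup>+x\<in>{0<..1/2}. ennreal (b x) \<partial>lborel) = (\<integral>\<^sup>+x\<in>{0<..1/2}. ennreal (B x) \<partial>lborel)"
    by (rule nn_integral_cong) (auto simp: b_def indicator_def)
  also have "ennreal C * \<dots> + ennreal K * emeasure lborel {\<gamma>..1/2} < \<infinity>"
    using fin \<gamma>(2) by (simp add: ennreal_mult_less_top)
  finally show ?thesis .
qed

lemma continuous_on_Icc_abs_bound:
  fixes k :: "real \<Rightarrow> real"
  assumes "continuous_on {a..b} k"
  obtains B where "B > 0" "\<And>x. x \<in> {a..b} \<Longrightarrow> \<bar>k x\<bar> \<le> B"
proof -
  have "bounded (k ` {a..b})" by (intro compact_imp_bounded compact_continuous_image assms compact_Icc)
  then show ?thesis using that by (auto simp: bounded_pos)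
qed

text \<open>If \<open>y < \<epsilon> x\<close> at one point near \<open>0\<close>, then the same holds for a profile with a slightly smaller
  speed, and since \<open>\<epsilon> x\<close> can only be crossed upwards, that profile also vanishes at \<open>0\<close>. This
  contradicts the minimality of the threshold speed.\<close>

lemma threshold_profile_lower_bound:
  fixes p cs :: real and f g \<rho> d y :: "real \<Rightarrow> real"
  defines "r \<equiv> 1 / (p - 1)"
  assumes "p > 1" and f: "continuous_on {0..1} f" and g: "continuous_on {0..1} g"
    and \<rho>: "continuous_on {0..1} \<rho>" and d: "continuous_on {0<..<1} d"
    and dpos: "\<And>x. x \<in> {0<..<1} \<Longrightarrow> d x > 0" and \<rho>pos: "\<And>x. x \<in> {0<..<1} \<Longrightarrow> \<rho> x > 0"
    and thr: "threshold_speed p f g \<rho> d cs"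
    and y: "unit_profile r (\<lambda>x. cs * g x - f x) (\<lambda>x. \<rho> x * d x powr r) y"
    and y1: "(y \<longlongrightarrow> 0) (at_left 1)"
    and lim: "((\<lambda>x. \<rho> x * (d x / x) powr r) \<longlongrightarrow> 0) (at_right 0)"
    and fg: "f 0 < cs * g 0"
  shows "\<exists>\<epsilon>>0. \<exists>\<delta>>0. \<forall>x. 0 < x \<longrightarrow> x < \<delta> \<longrightarrow> \<epsilon> * x \<le> y x"
proof -
  have "r > 0" using \<open>p > 1\<close> by (simp add: r_def)
  define D where "D x = \<rho> x * d x powr r" for x
  have Dpos: "D x > 0" if "x \<in> {0<..<1}" for x
    using dpos[OF that] \<rho>pos[OF that] by (simp add: D_def)
  have sub: "{0<..<1} \<subseteq> {0..1::real}" by auto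
  note cont = continuous_on_subset[OF f sub] continuous_on_subset[OF g sub] continuous_on_subset[OF \<rho> sub]
  have "d x \<noteq> 0" if "x \<in> {0<..<1}" for x using dpos[OF that] by simp
  then have contD: "continuous_on {0<..<1} D"
    unfolding D_def by (intro continuous_intros cont d) auto
  obtain G where G: "G > 0" "\<And>x. x \<in> {0..1} \<Longrightarrow> \<bar>g x\<bar> \<le> G"
    using continuous_on_Icc_abs_bound[OF g] by blast
  define h0 where "h0 = cs * g 0 - f 0"
  have "h0 > 0" using fg by (simp add: h0_def)
  \<comment> \<open>The quarter sets up a budget of slopes: near \<open>0\<close>, \<open>h\<close>
    exceeds \<open>3 * \<epsilon>\<close>; above the line \<open>\<epsilon> * x\<close> the singular
    term costs at most \<open>\<epsilon>\<close>; the change of speed costs at most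
    \<open>\<epsilon> / 2\<close>; and the line itself has slope \<open>\<epsilon>\<close>.\<close>
  define \<epsilon> where "\<epsilon> = h0 / 4"
  have "\<epsilon> > 0" using \<open>h0 > 0\<close> by (simp add: \<epsilon>_def)
  have "continuous_on {0..1} (\<lambda>x. cs * g x - f x)" by (intro continuous_intros f g)
  from continuous_on_Icc_at_rightD[OF this zero_less_one]
  have "((\<lambda>x. cs * g x - f x) \<longlongrightarrow> h0) (at_right 0)" by (simp add: h0_def)
  then have "\<forall>\<^sub>F x in at_right 0. 3 * \<epsilon> < cs * g x - f x"
    by (rule order_tendstoD(1)) (use \<open>h0 > 0\<close> in \<open>simp add: \<epsilon>_def\<close>)
  \<comment> \<open>Division by \<open>\<epsilon> powr r\<close>, which stems from
    \<open>(\<epsilon> * x) powr (- r)\<close>, turns this into the bound \<open>\<epsilon>\<close>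
    of \<open>small\<close>.\<close>
  moreover have "\<forall>\<^sub>F x in at_right 0. \<rho> x * (d x / x) powr r < \<epsilon> powr r * \<epsilon>"
    using order_tendstoD(2)[OF lim] \<open>\<epsilon> > 0\<close> by simp
  ultimately have "\<forall>\<^sub>F x in at_right 0. 3 * \<epsilon> < cs * g x - f x \<and> \<rho> x * (d x / x) powr r < \<epsilon> powr r * \<epsilon>"
    by (rule eventually_conj)
  then obtain \<delta>' where \<delta>': "\<delta>' > 0"
    "\<And>x. 0 < x \<Longrightarrow> x < \<delta>' \<Longrightarrow> 3 * \<epsilon> < cs * g x - f x \<and> \<rho> x * (d x / x) powr r < \<epsilon> powr r * \<epsilon>"
    using eventually_at_right[of 0 "1::real"] by auto
  define \<delta> where "\<delta> = min \<delta>' 1"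
  have \<delta>: "0 < \<delta>" "\<delta> \<le> 1" "\<delta> \<le> \<delta>'" using \<delta>'(1) by (auto simp: \<delta>_def)
  have small: "D x * s powr (- r) \<le> \<epsilon>" if x: "0 < x" "x < \<delta>" and s: "\<epsilon> * x \<le> s" for x s
  proof -
    have x': "x \<in> {0<..<1}" using x \<delta> by auto
    have "D x * s powr (- r) \<le> D x * (\<epsilon> * x) powr (- r)"
      using x s \<open>\<epsilon> > 0\<close> \<open>r > 0\<close> Dpos[OF x'] by (intro mult_left_mono powr_mono2') auto
    also have "\<dots> = (\<rho> x * (d x / x) powr r) / \<epsilon> powr r"
      using x \<open>\<epsilon> > 0\<close> dpos[OF x'] by (simp add: D_def powr_mult powr_divide powr_minus_divide)
    also have "\<dots> \<le> \<epsilon>" using \<delta>'(2)[of x] x \<delta> \<open>\<epsilon> > 0\<close> by (simp add: divide_le_eq mult.commute)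
    finally show ?thesis .
  qed
  have "\<epsilon> * x1 \<le> y x1" if x1: "0 < x1" "x1 < \<delta>" for x1
  proof (rule ccontr)
    assume "\<not> \<epsilon> * x1 \<le> y x1"
    \<comment> \<open>The first entry is below the gap at \<open>x1\<close>, so the perturbed
      profile still lies under the line there; the second respects the budget of slopes.\<close>
    define \<kappa> where "\<kappa> = min ((\<epsilon> * x1 - y x1) / 2) (\<epsilon> / 2)"
    have \<kappa>: "\<kappa> > 0" "\<kappa> < \<epsilon> * x1 - y x1" "\<kappa> \<le> \<epsilon> / 2"
      using \<open>\<not> \<epsilon> * x1 \<le> y x1\<close> \<open>\<epsilon> > 0\<close> by (auto simp: \<kappa>_def min_def)
    \<comment> \<open>As \<open>\<bar>g\<bar> \<le> G\<close>, this decrease of the speed changes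
      \<open>h\<close> by at most \<open>\<kappa>\<close>, whatever the sign of
      \<open>g\<close>.\<close>
    define c where "c = cs - \<kappa> / G"
    have c: "c < cs" using \<kappa>(1) G(1) by (simp add: c_def)
    have diff: "\<bar>(cs * g x - f x) - (c * g x - f x)\<bar> \<le> \<kappa>" if "x \<in> {0<..<1}" for x
    proof -
      have "(cs * g x - f x) - (c * g x - f x) = \<kappa> * (g x / G)"
        by (simp add: c_def algebra_simps)
      then have "\<bar>(cs * g x - f x) - (c * g x - f x)\<bar> = \<kappa> * \<bar>g x / G\<bar>"
        using \<kappa>(1) by (simp only: abs_mult)
      also have "\<dots> \<le> \<kappa> * 1"
        using \<kappa>(1) G(1) G(2)[of x] that by (intro mult_left_mono) (auto simp: abs_divide)
      finally show ?thesis by simp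
    qed
    have "continuous_on {0<..<1} (\<lambda>x. c * g x - f x)" by (intro continuous_intros cont)
    from unit_profile_perturb[OF \<open>r > 0\<close> contD Dpos this y[folded D_def] less_imp_le[OF \<kappa>(1)] diff]
    obtain z where z: "unit_profile r (\<lambda>x. c * g x - f x) D z"
      and zy: "\<And>x. x \<in> {0<..<1} \<Longrightarrow> \<bar>z x - y x\<bar> \<le> \<kappa> * (1 - x)" by blast
    have zpos: "z x > 0" if "x \<in> {0<..<1}" for x using z that by (simp add: unit_profile_def)
    have x1': "x1 \<in> {0<..<1}" using x1 \<delta> by auto
    have "\<kappa> * (1 - x1) \<le> \<kappa>" using \<kappa>(1) x1 by (simp add: mult_le_cancel_left1)
    then have z1: "z x1 < \<epsilon> * x1" using zy[OF x1'] \<kappa>(2) by linarith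
    \<comment> \<open>Above the line \<open>z v - \<epsilon> * v\<close> is nondecreasing, so a
      point above it to the left of \<open>x1\<close> would force \<open>z\<close> above it at
      \<open>x1\<close> as well.\<close>
    have z_le: "z x \<le> \<epsilon> * x" if x: "0 < x" "x < x1" for x
    proof (rule ccontr)
      assume "\<not> z x \<le> \<epsilon> * x"
      have der: "((\<lambda>v. z v - \<epsilon> * v) has_real_derivative (c * g v - f v - D v * z v powr (- r)) - \<epsilon>) (at v)"
        if "v \<in> {0<..<1}" for v
        using z that by (auto simp: unit_profile_def intro!: derivative_eq_intros)
      have "z x - \<epsilon> * x \<le> z x1 - \<epsilon> * x1"
      proof (rule DERIV_nonneg_while_pos_imp_nondecreasing[of x x1 "\<lambda>v. z v - \<epsilon> * v"])
        show "continuous_on {x..x1} (\<lambda>v. z v - \<epsilon> * v)"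
          using x x1' by (intro continuous_at_imp_continuous_on ballI DERIV_isCont[OF der]) auto
        fix v assume v: "x < v" "v < x1" "0 < z v - \<epsilon> * v"
        have v': "v \<in> {0<..<1}" "0 < v" "v < \<delta>" using v x x1 \<delta> by auto
        have "D v * z v powr (- r) \<le> \<epsilon>" using small[of v "z v"] v v' by simp
        moreover have "3 * \<epsilon> < cs * g v - f v" using \<delta>'(2)[of v] v' \<delta> by simp
        ultimately have "0 \<le> (c * g v - f v - D v * z v powr (- r)) - \<epsilon>"
          using diff[OF v'(1)] \<kappa>(3) \<open>\<epsilon> > 0\<close> by linarith
        then show "\<exists>m. ((\<lambda>v. z v - \<epsilon> * v) has_real_derivative m) (at v) \<and> 0 \<le> m"
          using der[OF v'(1)] by blast
      qed (use x \<open>\<not> z x \<le> \<epsilon> * x\<close> in auto)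
      then show False using z1 \<open>\<not> z x \<le> \<epsilon> * x\<close> by simp
    qed
    \<comment> \<open>Squeezing \<open>z\<close> below the line at \<open>0\<close>, and below
      \<open>y x + \<kappa> * (1 - x)\<close> at \<open>1\<close>, gives both boundary values and
      hence a wave with the speed \<open>c < cs\<close>.\<close>
    have "(z \<longlongrightarrow> 0) (at_right 0)"
    proof (rule tendsto_sandwich[of "\<lambda>_. 0" z _ "\<lambda>x. \<epsilon> * x"])
      show "\<forall>\<^sub>F x in at_right 0. 0 \<le> z x"
        by (rule eventually_at_rightI[of 0 1]) (simp_all add: zpos less_imp_le)
      show "\<forall>\<^sub>F x in at_right 0. z x \<le> \<epsilon> * x"
        by (rule eventually_at_rightI[of 0 x1]) (simp_all add: z_le x1)
      have "((\<lambda>x. \<epsilon> * x) \<longlongrightarrow> \<epsilon> * 0) (at_right 0)" by (intro tendsto_intros)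
      then show "((\<lambda>x. \<epsilon> * x) \<longlongrightarrow> 0) (at_right 0)" by simp
    qed simp
    moreover have "(z \<longlongrightarrow> 0) (at_left 1)"
    proof (rule tendsto_sandwich[of "\<lambda>_. 0" z _ "\<lambda>x. y x + \<kappa> * (1 - x)"])
      show "\<forall>\<^sub>F x in at_left 1. 0 \<le> z x"
        by (rule eventually_at_leftI[of 0]) (simp_all add: zpos less_imp_le)
      show "\<forall>\<^sub>F x in at_left 1. z x \<le> y x + \<kappa> * (1 - x)"
      proof (rule eventually_at_leftI[of 0])
        show "z x \<le> y x + \<kappa> * (1 - x)" if "x \<in> {0<..<1}" for x
          using zy[OF that] by linarith
      qed simp
      have "((\<lambda>x. y x + \<kappa> * (1 - x)) \<longlongrightarrow> 0 + \<kappa> * (1 - 1)) (at_left 1)" by (intro tendsto_intros y1)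
      then show "((\<lambda>x. y x + \<kappa> * (1 - x)) \<longlongrightarrow> 0) (at_left 1)" by simp
    qed simp
    ultimately have "\<exists>\<alpha> \<beta> u. travelling_wave p f g \<rho> d c \<alpha> \<beta> u"
      using profile_imp_travelling_wave[OF \<open>p > 1\<close> cont d dpos] z
      unfolding r_def D_def by blast
    then have "cs \<le> c" using thr by (simp add: threshold_speed_def)
    with c show False by simp
  qed
  with \<open>\<epsilon> > 0\<close> \<delta>(1) show ?thesis by blast
qed

section \<open>Finiteness of the right endpoint in the three cases\<close>

theorem theorem14:
  fixes p l0 cstar :: real and f g \<rho> d u :: "real \<Rightarrow> real" and \<alpha> \<beta> :: ereal
  assumes "p > 1"
    and "continuous_on {0..1} f" and "continuous_on {0..1} g" and "continuous_on {0..1} \<rho>"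
    and "d C1_differentiable_on {0<..<1}"
    and "\<forall>x\<in>{0<..<1}. \<rho> x > 0" and "\<rho> 0 = 0" and "\<rho> 1 = 0"
    and "g 0 > 0" and "\<forall>x\<in>{0<..1}. integral {0..x} g > 0"
    and "\<forall>x\<in>{0<..<1}. d x > 0"
    and "set_integrable lborel {0<..<1} (\<lambda>x. \<rho> x * d x powr (1 / (p - 1)))"
    and "((\<lambda>x. \<rho> x * (d x / x) powr (1 / (p - 1))) \<longlongrightarrow> l0) (at_right 0)"
    and "threshold_speed p f g \<rho> d cstar"
    and "travelling_wave p f g \<rho> d cstar \<alpha> \<beta> u"
  shows
    "(l0 > 0 \<longrightarrow>
        (\<beta> < \<infinity> \<longleftrightarrow> (\<integral>\<^sup>+x\<in>{0<..1/2}. ennreal (1 / \<rho> x) \<partial>lborel) < \<infinity>)) \<and>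
     (l0 = 0 \<and> cstar * g 0 > f 0 \<longrightarrow>
        (\<beta> < \<infinity> \<longleftrightarrow>
          (\<integral>\<^sup>+x\<in>{0<..1/2}. ennreal ((d x / x) powr (1 / (p - 1))) \<partial>lborel) < \<infinity>)) \<and>
     (l0 = 0 \<and> cstar * g 0 - f 0 = 0 \<and>
      (\<exists>\<delta> \<mu> M \<xi>. \<delta> > 0 \<and> \<mu> > 0 \<and> M > 0 \<and> C1_on_closed_interval 0 \<delta> \<xi> \<and>
         (\<forall>x\<in>{0<..<\<delta>}. \<mu> * \<xi> x \<le> d x * \<rho> x powr (p - 1) \<and>
                          d x * \<rho> x powr (p - 1) \<le> M * \<xi> x)) \<longrightarrow>
        (\<integral>\<^sup>+x\<in>{0<..1/2}. ennreal (1 / \<rho> x) \<partial>lborel) < \<infinity> \<longrightarrow> \<beta> < \<infinity>)"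
proof -
  define r where "r = 1 / (p - 1)"
  define D where "D x = \<rho> x * d x powr r" for x
  define h where "h x = cstar * g x - f x" for x
  have "r > 0" and r1: "(p - 1) * r = 1" using \<open>p > 1\<close> by (simp_all add: r_def)
  have dpos: "d x > 0" and \<rho>pos: "\<rho> x > 0" if "x \<in> {0<..<1}" for x
    using assms that by blast+
  have ne: "x \<noteq> 0" "d x \<noteq> 0" "\<rho> x \<noteq> 0" "d x / x \<noteq> 0" if "x \<in> {0<..<1}" for x
    using dpos[OF that] \<rho>pos[OF that] that by auto
  have d: "continuous_on {0<..<1} d"
    using \<open>d C1_differentiable_on {0<..<1}\<close> by (rule C1_differentiable_imp_continuous_on)
  have \<rho>: "continuous_on {0<..<1} \<rho>" by (rule continuous_on_subset[OF assms(4)]) auto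
  note lim = assms(13)[folded r_def]
  obtain y where y: "unit_profile r h D y" and y0: "(y \<longlongrightarrow> 0) (at_right 0)"
    and y1: "(y \<longlongrightarrow> 0) (at_left 1)"
    and \<beta>: "\<beta> < \<infinity> \<longleftrightarrow> (\<integral>\<^sup>+x\<in>{0<..1/2}. ennreal ((d x / y x) powr r) \<partial>lborel) < \<infinity>"
  proof (rule travelling_wave_imp_profile[OF \<open>p > 1\<close> d dpos \<rho>pos assms(15)])
    fix y
    assume "unit_profile (1 / (p - 1)) (\<lambda>x. cstar * g x - f x) (\<lambda>x. \<rho> x * d x powr (1 / (p - 1))) y"
      "(y \<longlongrightarrow> 0) (at_right 0)" "(y \<longlongrightarrow> 0) (at_left 1)"
      "\<beta> < \<infinity> \<longleftrightarrow> (\<integral>\<^sup>+x\<in>{0<..1/2}. ennreal ((d x / y x) powr (1 / (p - 1))) \<partial>lborel) < \<infinity>"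
    then show thesis
      by (intro that) (simp_all only: r_def D_def[abs_def] h_def[abs_def])
  qed  have ypos: "y x > 0" if "x \<in> {0<..<1}" for x using y that by (simp add: unit_profile_def)
  have Dpos: "D x > 0" if "x \<in> {0<..<1}" for x using dpos[OF that] \<rho>pos[OF that] by (simp add: D_def)
  obtain H where H: "H > 0" "\<And>x. x \<in> {0<..<1} \<Longrightarrow> h x \<le> H"
  proof -
    have "continuous_on {0..1} h" unfolding h_def by (intro continuous_intros assms)
    then obtain B where B: "B > 0" "\<And>x. x \<in> {0..1} \<Longrightarrow> \<bar>h x\<bar> \<le> B"
      using continuous_on_Icc_abs_bound by blast
    have "h x \<le> B" if "x \<in> {0<..<1}" for x using B(2)[of x] that by simp
    with B(1) show ?thesis by (rule that)
  qed
  have upper: "y x \<le> H * x" if "x \<in> {0<..<1}" for x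
    by (rule unit_profile_upper_bound[OF y y0 less_imp_le[OF Dpos] H(2) that])
  have cont: "continuous_on {0<..<1} (\<lambda>x. (d x / y x) powr r)"
      "continuous_on {0<..<1} (\<lambda>x. (d x / x) powr r)" "continuous_on {0<..<1} (\<lambda>x. 1 / \<rho> x)"
    using ne ypos by (intro continuous_intros d \<rho> unit_profile_continuous_on[OF y]; force)+
  \<comment> \<open>Both (a) and (b) reduce to this equivalence once \<open>y\<close> is known to be comparable to \<open>x\<close>.\<close>
  have linear: "\<beta> < \<infinity> \<longleftrightarrow> (\<integral>\<^sup>+x\<in>{0<..1/2}. ennreal ((d x / x) powr r) \<partial>lborel) < \<infinity>"
    if lower: "\<exists>\<epsilon>>0. \<exists>\<delta>>0. \<forall>x. 0 < x \<longrightarrow> x < \<delta> \<longrightarrow> \<epsilon> * x \<le> y x"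
  proof -
    obtain \<epsilon> \<delta> where \<epsilon>: "\<epsilon> > 0" "\<delta> > 0" "\<And>x. 0 < x \<Longrightarrow> x < \<delta> \<Longrightarrow> \<epsilon> * x \<le> y x"
      using lower by blast
    have le: "(d x / y x) powr r \<le> (1 / \<epsilon>) powr r * (d x / x) powr r" if x: "0 < x" "x < \<delta>" "x < 1" for x
    proof -
      have x': "x \<in> {0<..<1}" using x by simp
      have "d x / y x \<le> d x / (\<epsilon> * x)"
        using \<epsilon>(1,3) x dpos[OF x'] by (intro divide_left_mono) (auto intro!: mult_pos_pos ypos x')
      also have "\<dots> = (1 / \<epsilon>) * (d x / x)" by simp
      finally have "(d x / y x) powr r \<le> ((1 / \<epsilon>) * (d x / x)) powr r"
        using \<open>r > 0\<close> dpos[OF x'] ypos[OF x'] by (intro powr_mono2) auto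
      then show ?thesis using \<epsilon>(1) x dpos[OF x'] by (simp only: powr_mult)
    qed
    have ge: "(d x / x) powr r \<le> H powr r * (d x / y x) powr r" if x: "0 < x" "x < 1" for x
    proof -
      have x': "x \<in> {0<..<1}" using x by simp
      have "d x / (H * x) \<le> d x / y x"
        using upper[OF x'] dpos[OF x'] ypos[OF x'] H(1) x by (intro divide_left_mono) auto
      then have "H * (d x / (H * x)) \<le> H * (d x / y x)" using H(1) by (intro mult_left_mono) auto
      then have "d x / x \<le> H * (d x / y x)" using H(1) by simp
      then have "(d x / x) powr r \<le> (H * (d x / y x)) powr r"
        using \<open>r > 0\<close> dpos[OF x'] x by (intro powr_mono2) auto
      then show ?thesis using H(1) dpos[OF x'] ypos[OF x'] by (simp only: powr_mult)
    qed
    show ?thesis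
      unfolding \<beta>
      using nn_integral_Ioc_half_finite_compare[OF cont(1,2) powr_ge_zero \<epsilon>(2) le]
        nn_integral_Ioc_half_finite_compare[OF cont(2,1) powr_ge_zero \<epsilon>(2) ge] by blast
  qed
  have eq: "\<rho> x * (d x / x) powr r = D x / x powr r" if "x \<in> {0<..<1}" for x
    using that dpos[OF that] by (simp add: D_def powr_divide)
  \<comment> \<open>The positive limit \<open>l0\<close> serves twice: it bounds \<open>D\<close>
    below by a multiple of \<open>x powr r\<close>, which yields the lower bound on
    \<open>y\<close>, and it makes \<open>(d / x) powr r\<close> comparable to
    \<open>1 / \<rho>\<close>.\<close>
  have a: "\<beta> < \<infinity> \<longleftrightarrow> (\<integral>\<^sup>+x\<in>{0<..1/2}. ennreal (1 / \<rho> x) \<partial>lborel) < \<infinity>" if "l0 > 0"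
  proof -
    have "\<forall>\<^sub>F x in at_right 0. l0 / 2 < \<rho> x * (d x / x) powr r \<and> \<rho> x * (d x / x) powr r < 2 * l0"
      by (intro eventually_conj order_tendstoD[OF lim]) (use \<open>l0 > 0\<close> in simp_all)
    then obtain \<delta>' where \<delta>': "\<delta>' > 0" "\<And>x. 0 < x \<Longrightarrow> x < \<delta>' \<Longrightarrow>
        l0 / 2 < \<rho> x * (d x / x) powr r \<and> \<rho> x * (d x / x) powr r < 2 * l0"
      using eventually_at_right[of 0 "1::real"] by auto
    define \<delta> where "\<delta> = min \<delta>' 1"
    have \<delta>: "0 < \<delta>" "\<delta> \<le> 1" "\<delta> \<le> \<delta>'" using \<delta>'(1) by (auto simp: \<delta>_def)
    have "\<exists>\<epsilon>>0. \<exists>\<delta>>0. \<forall>x. 0 < x \<longrightarrow> x < \<delta> \<longrightarrow> \<epsilon> * x \<le> y x"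
    proof (rule unit_profile_lower_bound[where \<xi>' = "\<lambda>_. 1" and B = 0 and m = "l0 / 2",
          OF \<open>r > 0\<close> y y0 H(2) \<delta>(1,2)])
      fix x assume x: "x \<in> {0<..<\<delta>}"
      then have "l0 / 2 < D x / x powr r" using \<delta>'(2)[of x] \<delta> eq[of x] by simp
      then show "l0 / 2 * x powr r \<le> D x" using x by (simp add: field_simps)
    qed (use \<open>l0 > 0\<close> in auto)
    then have 1: "\<beta> < \<infinity> \<longleftrightarrow> (\<integral>\<^sup>+x\<in>{0<..1/2}. ennreal ((d x / x) powr r) \<partial>lborel) < \<infinity>"
      by (rule linear)
    have le: "(d x / x) powr r \<le> 2 * l0 * (1 / \<rho> x)" "1 / \<rho> x \<le> 2 / l0 * (d x / x) powr r"
      if "0 < x" "x < \<delta>" "x < 1" for x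
    proof -
      have b: "l0 / 2 < \<rho> x * (d x / x) powr r" "\<rho> x * (d x / x) powr r < 2 * l0"
        using \<delta>'(2)[of x] \<delta> that by auto
      then show "(d x / x) powr r \<le> 2 * l0 * (1 / \<rho> x)" "1 / \<rho> x \<le> 2 / l0 * (d x / x) powr r"
        using \<rho>pos[of x] that \<open>l0 > 0\<close> by (simp_all add: field_simps)
    qed
    have "0 \<le> 2 * l0" "0 \<le> 2 / l0" using \<open>l0 > 0\<close> by simp_all
    then show ?thesis
      unfolding 1
      using nn_integral_Ioc_half_finite_compare[OF cont(2,3) _ \<delta>(1) le(1)]
        nn_integral_Ioc_half_finite_compare[OF cont(3,2) _ \<delta>(1) le(2)] by blast
  qed
  \<comment> \<open>With \<open>l0 = 0\<close> there is no such lower bound on \<open>D\<close>;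
    minimality of the speed supplies the lower bound on \<open>y\<close> instead.\<close>
  have b: "\<beta> < \<infinity> \<longleftrightarrow> (\<integral>\<^sup>+x\<in>{0<..1/2}. ennreal ((d x / x) powr r) \<partial>lborel) < \<infinity>"
    if "l0 = 0" "cstar * g 0 > f 0"
  proof (rule linear)
    show "\<exists>\<epsilon>>0. \<exists>\<delta>>0. \<forall>x. 0 < x \<longrightarrow> x < \<delta> \<longrightarrow> \<epsilon> * x \<le> y x"
      using threshold_profile_lower_bound[OF \<open>p > 1\<close> assms(2,3,4) d dpos \<rho>pos assms(14) _ y1 _ that(2)]
        y lim \<open>l0 = 0\<close> unfolding r_def D_def[abs_def] h_def[abs_def] by blast
  qed
  have c: "\<beta> < \<infinity>"
    if "(\<integral>\<^sup>+x\<in>{0<..1/2}. ennreal (1 / \<rho> x) \<partial>lborel) < \<infinity>"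
      and "\<delta>0 > 0" "\<mu> > 0" "M > 0" and C1: "C1_on_closed_interval 0 \<delta>0 \<xi>"
      and \<xi>: "\<And>x. x \<in> {0<..<\<delta>0} \<Longrightarrow> \<mu> * \<xi> x \<le> d x * \<rho> x powr (p - 1) \<and>
        d x * \<rho> x powr (p - 1) \<le> M * \<xi> x"
    for \<delta>0 \<mu> M \<xi>
  proof -
    define \<delta> where "\<delta> = min \<delta>0 1"
    have \<delta>: "0 < \<delta>" "\<delta> \<le> 1" "\<delta> \<le> \<delta>0" using \<open>\<delta>0 > 0\<close> by (auto simp: \<delta>_def)
    obtain \<xi>' where \<xi>': "continuous_on {0..\<delta>0} \<xi>'"
      "\<And>x. x \<in> {0..\<delta>0} \<Longrightarrow> (\<xi> has_real_derivative \<xi>' x) (at x within {0..\<delta>0})"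
      using C1 by (auto simp: C1_on_closed_interval_def)
    obtain B where B: "B > 0" "\<And>x. x \<in> {0..\<delta>0} \<Longrightarrow> \<bar>\<xi>' x\<bar> \<le> B"
      using continuous_on_Icc_abs_bound[OF \<xi>'(1)] by blast
    have unit: "x \<in> {0<..<1}" "x \<in> {0<..<\<delta>0}" if "x \<in> {0<..<\<delta>}" for x using that \<delta> by auto
    \<comment> \<open>The upper estimate by \<open>M * \<xi>\<close> forces \<open>\<xi>\<close> to
      be positive.\<close>
    have \<xi>pos: "\<xi> x > 0" if x: "x \<in> {0<..<\<delta>}" for x
    proof -
      have "0 < d x * \<rho> x powr (p - 1)" using dpos[OF unit(1)[OF x]] \<rho>pos[OF unit(1)[OF x]] by simp
      also have "\<dots> \<le> M * \<xi> x" using \<xi>[OF unit(2)[OF x]] by simp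
      finally show ?thesis using \<open>M > 0\<close> by (simp add: zero_less_mult_iff)
    qed
    \<comment> \<open>Raising to the power \<open>r\<close> turns the two-sided estimate by
      \<open>\<xi>\<close> into one of \<open>D\<close> by \<open>\<xi> powr r\<close>, since
      \<open>(p - 1) * r = 1\<close>.\<close>
    have Deq: "D x = (d x * \<rho> x powr (p - 1)) powr r" if "x \<in> {0<..<1}" for x
      using dpos[OF that] \<rho>pos[OF that] r1 by (simp add: D_def powr_mult powr_powr)
    have "\<exists>\<epsilon>>0. \<exists>\<delta>'>0. \<forall>x. 0 < x \<longrightarrow> x < \<delta>' \<longrightarrow> \<epsilon> * \<xi> x \<le> y x"
    proof (rule unit_profile_lower_bound[where \<xi>' = \<xi>' and B = B and m = "\<mu> powr r",
          OF \<open>r > 0\<close> y y0 H(2) \<delta>(1,2)])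
      fix x assume x: "x \<in> {0<..<\<delta>}"
      \<comment> \<open>At interior points the derivative within the closed interval is the ordinary
        one.\<close>
      show "(\<xi> has_real_derivative \<xi>' x) (at x)"
        using \<xi>'(2)[of x] unit(2)[OF x] by (simp add: at_within_Icc_at)
      show "- B \<le> \<xi>' x" using B(2)[of x] unit(2)[OF x] by auto
      show "0 < \<xi> x" by (rule \<xi>pos[OF x])
      have "\<mu> powr r * \<xi> x powr r = (\<mu> * \<xi> x) powr r"
        using \<open>\<mu> > 0\<close> \<xi>pos[OF x] by (simp add: powr_mult)
      also have "\<dots> \<le> D x"
        unfolding Deq[OF unit(1)[OF x]] using \<open>\<mu> > 0\<close> \<xi>pos[OF x] \<xi>[OF unit(2)[OF x]] \<open>r > 0\<close>
        by (intro powr_mono2) auto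
      finally show "\<mu> powr r * \<xi> x powr r \<le> D x" .
    qed (use \<open>\<mu> > 0\<close> B in auto)
    then obtain \<epsilon> \<delta>' where \<epsilon>: "\<epsilon> > 0" "\<delta>' > 0" "\<And>x. 0 < x \<Longrightarrow> x < \<delta>' \<Longrightarrow> \<epsilon> * \<xi> x \<le> y x"
      by blast
    \<comment> \<open>\<open>\<xi>\<close> cancels between \<open>D \<le> (M * \<xi>) powr r\<close>
      and \<open>y \<ge> \<epsilon> * \<xi>\<close>, which leaves a constant bound for
      \<open>\<rho> * (d / y) powr r\<close>.\<close>
    have le: "(d x / y x) powr r \<le> (M / \<epsilon>) powr r * (1 / \<rho> x)" if x: "0 < x" "x < min \<delta> \<delta>'" "x < 1" for x
    proof -
      have x': "x \<in> {0<..<1}" "x \<in> {0<..<\<delta>}" using x by auto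
      have "\<rho> x * (d x / y x) powr r = D x / y x powr r"
        using dpos[OF x'(1)] ypos[OF x'(1)] by (simp add: D_def powr_divide)
      also have "\<dots> \<le> (M * \<xi> x) powr r / (\<epsilon> * \<xi> x) powr r"
        unfolding Deq[OF x'(1)]
        using \<xi>[OF unit(2)[OF x'(2)]] \<open>r > 0\<close> \<epsilon>(1) \<epsilon>(3)[of x] x \<xi>pos[OF x'(2)] dpos[OF x'(1)] \<rho>pos[OF x'(1)]
        by (intro frac_le powr_mono2) auto
      also have "\<dots> = (M / \<epsilon>) powr r"
        using \<xi>pos[OF x'(2)] \<open>M > 0\<close> \<epsilon>(1) by (simp add: powr_mult powr_divide)
      finally show ?thesis using \<rho>pos[OF x'(1)] by (simp add: field_simps)
    qed
    have "min \<delta> \<delta>' > 0" using \<delta>(1) \<epsilon>(2) by simp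
    from nn_integral_Ioc_half_finite_compare[OF cont(1,3) powr_ge_zero this le that(1)]
    show ?thesis unfolding \<beta> .
  qed
  show ?thesis
    unfolding r_def[symmetric] using a b c by blast
qed

end
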